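(* Let $\tilde{\mathcal{A}}$ and $\mathcal{A}$ be unital $C^*$-algebras with units $\tilde e$ and $e$, and let $\Phi:\tilde{\mathcal{A}}\to\mathcal{A}$ be a unital Schwarz map, i.e. a linear map with $\Phi(\tilde e)=e$, $\Phi(a^* )=\Phi(a)^*$ and $\Phi(a^* )\Phi(a)\leq\Phi(a^*a)$ for all $a\in\tilde{\mathcal{A}}$. Let $\omega,\nu$ be positive linear functionals on $\mathcal{A}$, and let $\omega_\Phi=\omega\circ\Phi$, $\nu_\Phi=\nu\circ\Phi$. Then $$S[\omega,\nu]\geq S[\omega_\Phi,\nu_\Phi].$$
   Context: For a positive linear functional $\omega$ on a unital $C^*$-algebra $\mathcal{A}$ define the positive Hermitian quadratic forms $\omega^R(a,b)=\omega(ba^* )$ and $\omega^L(a,b)=\omega(a^*b)$ on $\mathcal{A}$. For two positive Hermitian quadratic forms $p,q$ on a complex vector space $\mathcal{V}$: let $\mathcal{N}=\{a: p(a,a)+q(a,a)=0\}$, let $\mathcal{H}$ be the completion of $\mathcal{V}/\mathcal{N}$ with inner product $\langle[a],[b]\rangle=p(a,b)+q(a,b)$, let $P,Q$ be the bounded positive (commuting, $P+Q=\mathbb{I}$) operators on $\mathcal{H}$ with $p(a,b)=\langle[a],P[b]\rangle$, $q(a,b)=\langle[a],Q[b]\rangle$, and define the interpolation $\gamma^t_{[p,q]}(a,b)=\langle[a],P^{1-t}Q^t[b]\rangle$ for $t\in[0,1]$. The relative entropy functional of $\omega,\nu$ is $S_{[\omega,\nu]}(a,b)=-\liminf_{t\to0^+}\frac1t\big(\gamma^t_{[\omega^R,\nu^L]}(a,b)-\omega^R(a,b)\big)$,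 and the relative entropy is $S[\omega,\nu]=S_{[\omega,\nu]}(e,e)$ with $e$ the unit of $\mathcal{A}$. *)

theory Defs
  imports "HOL-Analysis.Analysis" "HOL-Computational_Algebra.Polynomial"
begin

text \<open>A unital complex C*-algebra is modelled on a type 'a that is a real unital
Banach algebra (norm 1 = 1), together with a central element ii with ii*ii = -1
(multiplication by the imaginary unit, giving the complex structure) and an
involution st.  Complex scalar multiplication is z.a = Re z a + Im z (ii a).\<close>

definition cscale :: "'a::real_normed_algebra_1 \<Rightarrow> complex \<Rightarrow> 'a \<Rightarrow> 'a" where
  "cscale ii z a = scaleR (Re z) a + scaleR (Im z) (ii * a)"

definition unital_cstar_algebra ::
  "'a::{real_normed_algebra_1,banach} \<Rightarrow> ('a \<Rightarrow> 'a) \<Rightarrow> bool" where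
  "unital_cstar_algebra ii st \<longleftrightarrow>
     ii * ii = -1 \<and> (\<forall>a. ii * a = a * ii) \<and>
     (\<forall>z a. norm (cscale ii z a) = cmod z * norm a) \<and>
     (\<forall>a b. st (a + b) = st a + st b) \<and>
     (\<forall>z a. st (cscale ii z a) = cscale ii (cnj z) (st a)) \<and>
     (\<forall>a b. st (a * b) = st b * st a) \<and>
     (\<forall>a. st (st a) = a) \<and>
     (\<forall>a. norm (st a * a) = (norm a)^2)"

definition cstar_pos :: "('a::ring_1 \<Rightarrow> 'a) \<Rightarrow> 'a \<Rightarrow> bool" where
  "cstar_pos st a \<longleftrightarrow> (\<exists>x. a = st x * x)"

definition cstar_le :: "('a::ring_1 \<Rightarrow> 'a) \<Rightarrow> 'a \<Rightarrow> 'a \<Rightarrow> bool" where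
  "cstar_le st a b \<longleftrightarrow> cstar_pos st (b - a)"

definition clinear_map ::
  "'a::real_normed_algebra_1 \<Rightarrow> 'b::real_normed_algebra_1 \<Rightarrow> ('a \<Rightarrow> 'b) \<Rightarrow> bool" where
  "clinear_map ii1 ii2 \<Phi> \<longleftrightarrow>
     (\<forall>a b. \<Phi> (a + b) = \<Phi> a + \<Phi> b) \<and>
     (\<forall>z a. \<Phi> (cscale ii1 z a) = cscale ii2 z (\<Phi> a))"

definition unital_schwarz_map ::
  "'a::real_normed_algebra_1 \<Rightarrow> ('a \<Rightarrow> 'a) \<Rightarrow> 'b::real_normed_algebra_1 \<Rightarrow> ('b \<Rightarrow> 'b)
     \<Rightarrow> ('a \<Rightarrow> 'b) \<Rightarrow> bool" where
  "unital_schwarz_map ii1 st1 ii2 st2 \<Phi> \<longleftrightarrow>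
     clinear_map ii1 ii2 \<Phi> \<and> \<Phi> 1 = 1 \<and>
     (\<forall>a. \<Phi> (st1 a) = st2 (\<Phi> a)) \<and>
     (\<forall>a. cstar_le st2 (\<Phi> (st1 a) * \<Phi> a) (\<Phi> (st1 a * a)))"

definition pos_functional ::
  "'a::real_normed_algebra_1 \<Rightarrow> ('a \<Rightarrow> 'a) \<Rightarrow> ('a \<Rightarrow> complex) \<Rightarrow> bool" where
  "pos_functional ii st \<omega> \<longleftrightarrow>
     (\<forall>a b. \<omega> (a + b) = \<omega> a + \<omega> b) \<and>
     (\<forall>z a. \<omega> (cscale ii z a) = z * \<omega> a) \<and>
     (\<forall>a. Im (\<omega> (st a * a)) = 0 \<and> 0 \<le> Re (\<omega> (st a * a)))"

definition omegaR :: "('a::ring_1 \<Rightarrow> 'a) \<Rightarrow> ('a \<Rightarrow> complex) \<Rightarrow> 'a \<Rightarrow> 'a \<Rightarrow> complex" where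
  "omegaR st \<omega> a b = \<omega> (b * st a)"

definition omegaL :: "('a::ring_1 \<Rightarrow> 'a) \<Rightarrow> ('a \<Rightarrow> complex) \<Rightarrow> 'a \<Rightarrow> 'a \<Rightarrow> complex" where
  "omegaL st \<omega> a b = \<omega> (st a * b)"

text \<open>V is a complex vector space given by a type 'v (additive group) and a complex
scalar multiplication sc.  The completion of V/N with respect to s = p + q is
realised as the set of equivalence classes of s-Cauchy sequences in V
(two Cauchy sequences being equivalent iff s(X n - Y n, X n - Y n) tends to 0);
[a] is the class of the constant sequence a.  Operators on the completion are
functions on classes, normalised to the empty set outside the completion.\<close>

definition sform :: "('v \<Rightarrow> 'v \<Rightarrow> complex) \<Rightarrow> ('v \<Rightarrow> 'v \<Rightarrow> complex) \<Rightarrow> 'v \<Rightarrow> 'v \<Rightarrow> complex" where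
  "sform p q a b = p a b + q a b"

definition s_cauchy :: "('v::ab_group_add \<Rightarrow> 'v \<Rightarrow> complex) \<Rightarrow> ('v \<Rightarrow> 'v \<Rightarrow> complex) \<Rightarrow> (nat \<Rightarrow> 'v) \<Rightarrow> bool" where
  "s_cauchy p q X \<longleftrightarrow> (\<forall>\<epsilon>>0. \<exists>N. \<forall>m\<ge>N. \<forall>n\<ge>N. Re (sform p q (X m - X n) (X m - X n)) < \<epsilon>)"

definition s_equiv :: "('v::ab_group_add \<Rightarrow> 'v \<Rightarrow> complex) \<Rightarrow> ('v \<Rightarrow> 'v \<Rightarrow> complex) \<Rightarrow> (nat \<Rightarrow> 'v) \<Rightarrow> (nat \<Rightarrow> 'v) \<Rightarrow> bool" where
  "s_equiv p q X Y \<longleftrightarrow> (\<lambda>n. Re (sform p q (X n - Y n) (X n - Y n))) \<longlonglongrightarrow> 0"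

definition hcls :: "('v::ab_group_add \<Rightarrow> 'v \<Rightarrow> complex) \<Rightarrow> ('v \<Rightarrow> 'v \<Rightarrow> complex) \<Rightarrow> (nat \<Rightarrow> 'v) \<Rightarrow> (nat \<Rightarrow> 'v) set" where
  "hcls p q X = {Y. s_cauchy p q Y \<and> s_equiv p q X Y}"

definition hspace :: "('v::ab_group_add \<Rightarrow> 'v \<Rightarrow> complex) \<Rightarrow> ('v \<Rightarrow> 'v \<Rightarrow> complex) \<Rightarrow> (nat \<Rightarrow> 'v) set set" where
  "hspace p q = hcls p q ` {X. s_cauchy p q X}"

definition hrep :: "(nat \<Rightarrow> 'v) set \<Rightarrow> nat \<Rightarrow> 'v" where
  "hrep h = (SOME X. X \<in> h)"

definition hemb :: "('v::ab_group_add \<Rightarrow> 'v \<Rightarrow> complex) \<Rightarrow> ('v \<Rightarrow> 'v \<Rightarrow> complex) \<Rightarrow> 'v \<Rightarrow> (nat \<Rightarrow> 'v) set" where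
  "hemb p q a = hcls p q (\<lambda>_. a)"

definition hzero :: "('v::ab_group_add \<Rightarrow> 'v \<Rightarrow> complex) \<Rightarrow> ('v \<Rightarrow> 'v \<Rightarrow> complex) \<Rightarrow> (nat \<Rightarrow> 'v) set" where
  "hzero p q = hcls p q (\<lambda>_. 0)"

definition hplus :: "('v::ab_group_add \<Rightarrow> 'v \<Rightarrow> complex) \<Rightarrow> ('v \<Rightarrow> 'v \<Rightarrow> complex)
    \<Rightarrow> (nat \<Rightarrow> 'v) set \<Rightarrow> (nat \<Rightarrow> 'v) set \<Rightarrow> (nat \<Rightarrow> 'v) set" where
  "hplus p q h k = hcls p q (\<lambda>n. hrep h n + hrep k n)"

definition hscale :: "(complex \<Rightarrow> 'v \<Rightarrow> 'v) \<Rightarrow> ('v::ab_group_add \<Rightarrow> 'v \<Rightarrow> complex) \<Rightarrow> ('v \<Rightarrow> 'v \<Rightarrow> complex)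
    \<Rightarrow> complex \<Rightarrow> (nat \<Rightarrow> 'v) set \<Rightarrow> (nat \<Rightarrow> 'v) set" where
  "hscale sc p q z h = hcls p q (\<lambda>n. sc z (hrep h n))"

definition hminus :: "(complex \<Rightarrow> 'v \<Rightarrow> 'v) \<Rightarrow> ('v::ab_group_add \<Rightarrow> 'v \<Rightarrow> complex) \<Rightarrow> ('v \<Rightarrow> 'v \<Rightarrow> complex)
    \<Rightarrow> (nat \<Rightarrow> 'v) set \<Rightarrow> (nat \<Rightarrow> 'v) set \<Rightarrow> (nat \<Rightarrow> 'v) set" where
  "hminus sc p q h k = hplus p q h (hscale sc p q (-1) k)"

definition hinner :: "('v::ab_group_add \<Rightarrow> 'v \<Rightarrow> complex) \<Rightarrow> ('v \<Rightarrow> 'v \<Rightarrow> complex)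
    \<Rightarrow> (nat \<Rightarrow> 'v) set \<Rightarrow> (nat \<Rightarrow> 'v) set \<Rightarrow> complex" where
  "hinner p q h k = lim (\<lambda>n. sform p q (hrep h n) (hrep k n))"

definition hnorm :: "('v::ab_group_add \<Rightarrow> 'v \<Rightarrow> complex) \<Rightarrow> ('v \<Rightarrow> 'v \<Rightarrow> complex)
    \<Rightarrow> (nat \<Rightarrow> 'v) set \<Rightarrow> real" where
  "hnorm p q h = sqrt (Re (hinner p q h h))"

definition is_bop :: "(complex \<Rightarrow> 'v \<Rightarrow> 'v) \<Rightarrow> ('v::ab_group_add \<Rightarrow> 'v \<Rightarrow> complex) \<Rightarrow> ('v \<Rightarrow> 'v \<Rightarrow> complex)
    \<Rightarrow> ((nat \<Rightarrow> 'v) set \<Rightarrow> (nat \<Rightarrow> 'v) set) \<Rightarrow> bool" where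
  "is_bop sc p q T \<longleftrightarrow>
     (\<forall>h\<in>hspace p q. T h \<in> hspace p q) \<and>
     (\<forall>h\<in>hspace p q. \<forall>k\<in>hspace p q. T (hplus p q h k) = hplus p q (T h) (T k)) \<and>
     (\<forall>z. \<forall>h\<in>hspace p q. T (hscale sc p q z h) = hscale sc p q z (T h)) \<and>
     (\<exists>C. \<forall>h\<in>hspace p q. hnorm p q (T h) \<le> C * hnorm p q h) \<and>
     (\<forall>h. h \<notin> hspace p q \<longrightarrow> T h = {})"

definition bop_of :: "(complex \<Rightarrow> 'v \<Rightarrow> 'v) \<Rightarrow> ('v::ab_group_add \<Rightarrow> 'v \<Rightarrow> complex) \<Rightarrow> ('v \<Rightarrow> 'v \<Rightarrow> complex)
    \<Rightarrow> ('v \<Rightarrow> 'v \<Rightarrow> complex) \<Rightarrow> ((nat \<Rightarrow> 'v) set \<Rightarrow> (nat \<Rightarrow> 'v) set)" where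
  "bop_of sc p q r = (THE T. is_bop sc p q T \<and>
      (\<forall>a b. r a b = hinner p q (hemb p q a) (T (hemb p q b))))"

definition polyop :: "(complex \<Rightarrow> 'v \<Rightarrow> 'v) \<Rightarrow> ('v::ab_group_add \<Rightarrow> 'v \<Rightarrow> complex) \<Rightarrow> ('v \<Rightarrow> 'v \<Rightarrow> complex)
    \<Rightarrow> ((nat \<Rightarrow> 'v) set \<Rightarrow> (nat \<Rightarrow> 'v) set) \<Rightarrow> real poly \<Rightarrow> (nat \<Rightarrow> 'v) set \<Rightarrow> (nat \<Rightarrow> 'v) set" where
  "polyop sc p q T g h =
     foldr (\<lambda>c acc. hplus p q (hscale sc p q (complex_of_real c) h) (T acc)) (coeffs g) (hzero p q)"

text \<open>Continuous functional calculus f(T) for an operator T with 0 <= T <= I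
(spectrum in [0,1]): f(T) h is the limit of g_n(T) h for every sequence of
polynomials g_n converging uniformly to f on [0,1].\<close>
definition opfun :: "(complex \<Rightarrow> 'v \<Rightarrow> 'v) \<Rightarrow> ('v::ab_group_add \<Rightarrow> 'v \<Rightarrow> complex) \<Rightarrow> ('v \<Rightarrow> 'v \<Rightarrow> complex)
    \<Rightarrow> (real \<Rightarrow> real) \<Rightarrow> ((nat \<Rightarrow> 'v) set \<Rightarrow> (nat \<Rightarrow> 'v) set) \<Rightarrow> ((nat \<Rightarrow> 'v) set \<Rightarrow> (nat \<Rightarrow> 'v) set)" where
  "opfun sc p q f T = (THE F.
      (\<forall>h. h \<notin> hspace p q \<longrightarrow> F h = {}) \<and>
      (\<forall>h\<in>hspace p q. F h \<in> hspace p q) \<and>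
      (\<forall>h\<in>hspace p q. \<forall>g :: nat \<Rightarrow> real poly.
          (\<forall>\<epsilon>>0. \<exists>N. \<forall>n\<ge>N. \<forall>x\<in>{0..1}. \<bar>poly (g n) x - f x\<bar> < \<epsilon>) \<longrightarrow>
          (\<lambda>n. hnorm p q (hminus sc p q (polyop sc p q T (g n) h) (F h))) \<longlonglongrightarrow> 0))"

definition pw :: "real \<Rightarrow> real \<Rightarrow> real" where
  "pw s x = (if s = 0 then 1 else x powr s)"

definition gamma_interp :: "(complex \<Rightarrow> 'v \<Rightarrow> 'v) \<Rightarrow> ('v::ab_group_add \<Rightarrow> 'v \<Rightarrow> complex) \<Rightarrow> ('v \<Rightarrow> 'v \<Rightarrow> complex)
    \<Rightarrow> real \<Rightarrow> 'v \<Rightarrow> 'v \<Rightarrow> complex" where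
  "gamma_interp sc p q t a b =
     hinner p q (hemb p q a)
       (opfun sc p q (pw (1 - t)) (bop_of sc p q p)
         (opfun sc p q (pw t) (bop_of sc p q q) (hemb p q b)))"

text \<open>S[omega,nu] = S_[omega,nu](e,e) = - liminf_{t->0+} (gamma^t(e,e) - omega^R(e,e))/t,
valued in the extended reals (both quantities are real at (e,e); we take real parts).\<close>
definition rel_entropy ::
  "'a::real_normed_algebra_1 \<Rightarrow> ('a \<Rightarrow> 'a) \<Rightarrow> ('a \<Rightarrow> complex) \<Rightarrow> ('a \<Rightarrow> complex) \<Rightarrow> ereal" where
  "rel_entropy ii st \<omega> \<nu> =
     - Liminf (at_right (0::real))
         (\<lambda>t. ereal ((Re (gamma_interp (cscale ii) (omegaR st \<omega>) (omegaL st \<nu>) t 1 1)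
                       - Re (omegaR st \<omega> 1 1)) / t))"

end

theory Submission
  imports Defs
begin

text \<open>
  For the forms p, q on the source and p', q' on the target, the Schwarz inequality says
  p'(Phi a, Phi a) \<le> p(a, a) and q'(Phi a, Phi a) \<le> q(a, a). The parallel sum of p and l q at a is the
  infimum over b of p(b, b) + l q(a - b, a - b), so it is monotone under such a Phi. In the functional
  calculus of P (with Q = 1 - P) it corresponds to the function l u (1 - u) / (u + l (1 - u)), and
  u^(1-t) (1-u)^t is, up to a factor arbitrarily close to 1, a positive combination of these functions.
  Hence the interpolated form is monotone as well, and so is its difference quotient at t = 0, because
  omega(e) does not change.
\<close>

subsection \<open>Semi-inner products and Hilbert spaces on a carrier\<close>

text \<open>Phi need not carry the operator P of the source to that of the target; the hypotheses
  compare only diagonal values of two forms. Parallel sums bridge this gap: the infimum involves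
  nothing but such values, and Phi sends a splitting of a to a splitting of Phi a. For omega^R the
  Schwarz inequality is taken at the adjoint of a. The scalar approximation is a finite sum with a
  factor q^2 and an additive error e, so no integral of operators occurs; both errors are removed in
  a final limit.

  The completion is a set of classes inside a type, so Hilbert space theory is developed over a
  carrier. The locales record only how the operations behave under the inner product, and vector
  identities are proved by pairing with test vectors. The functional calculus is defined by
  polynomial limits, so everything rests on one fact: g >= 0 on [0,1] implies <x, g(T) x> >= 0 for 0
  <= T <= 1. It comes from Bernstein expansions instead of spectral theory.\<close>

locale semi_ip =
  fixes H :: "'h set" and pl :: "'h \<Rightarrow> 'h \<Rightarrow> 'h" and sc :: "complex \<Rightarrow> 'h \<Rightarrow> 'h"
    and ip :: "'h \<Rightarrow> 'h \<Rightarrow> complex"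
  assumes pl_closed [simp]: "x \<in> H \<Longrightarrow> y \<in> H \<Longrightarrow> pl x y \<in> H"
    and sc_closed [simp]: "x \<in> H \<Longrightarrow> sc c x \<in> H"
    and ip_pl [simp]: "x \<in> H \<Longrightarrow> y \<in> H \<Longrightarrow> z \<in> H \<Longrightarrow> ip z (pl x y) = ip z x + ip z y"
    and ip_sc [simp]: "x \<in> H \<Longrightarrow> z \<in> H \<Longrightarrow> ip z (sc c x) = c * ip z x"
    and ip_cnj: "x \<in> H \<Longrightarrow> y \<in> H \<Longrightarrow> ip y x = cnj (ip x y)"
    and ip_pos: "x \<in> H \<Longrightarrow> 0 \<le> Re (ip x x)"
begin

definition nrm :: "'h \<Rightarrow> real" where "nrm x = sqrt (Re (ip x x))"
definition dif :: "'h \<Rightarrow> 'h \<Rightarrow> 'h" where "dif x y = pl x (sc (-1) y)"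

lemma ip_pl_left [simp]: "x \<in> H \<Longrightarrow> y \<in> H \<Longrightarrow> z \<in> H \<Longrightarrow> ip (pl x y) z = ip x z + ip y z"
  by (subst (1 2 3) ip_cnj) auto

lemma ip_sc_left [simp]: "x \<in> H \<Longrightarrow> z \<in> H \<Longrightarrow> ip (sc c x) z = cnj c * ip x z"
  by (subst (1 2) ip_cnj) auto

lemma dif_closed [simp]: "x \<in> H \<Longrightarrow> y \<in> H \<Longrightarrow> dif x y \<in> H"
  by (simp add: dif_def)

lemma ip_dif [simp]: "x \<in> H \<Longrightarrow> y \<in> H \<Longrightarrow> z \<in> H \<Longrightarrow> ip z (dif x y) = ip z x - ip z y"
  by (simp add: dif_def)

lemma ip_dif_left [simp]: "x \<in> H \<Longrightarrow> y \<in> H \<Longrightarrow> z \<in> H \<Longrightarrow> ip (dif x y) z = ip x z - ip y z"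
  by (simp add: dif_def)

lemma Im_ip_self: "x \<in> H \<Longrightarrow> Im (ip x x) = 0"
  using ip_cnj[of x x] by (simp add: complex_eq_iff)

lemma Re_ip_commute: "x \<in> H \<Longrightarrow> y \<in> H \<Longrightarrow> Re (ip y x) = Re (ip x y)"
  by (subst ip_cnj) auto

lemma nrm_nonneg [simp]: "x \<in> H \<Longrightarrow> 0 \<le> nrm x"
  by (simp add: nrm_def ip_pos)

lemma nrm_sq: "x \<in> H \<Longrightarrow> (nrm x)\<^sup>2 = Re (ip x x)"
  by (simp add: nrm_def ip_pos)

lemma cauchy_schwarz:
  assumes [simp]: "x \<in> H" "y \<in> H"
  shows "cmod (ip x y) \<le> nrm x * nrm y"
proof -
  define c where "c = ip x y"
  have c2: "ip y x = cnj c" unfolding c_def by (rule ip_cnj) auto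
  have cc: "Re (c * cnj c) = (cmod c)\<^sup>2" by (simp add: complex_norm_square[symmetric])
  have key: "0 \<le> Re (ip x x) + 2 * s * (cmod c)\<^sup>2 + s\<^sup>2 * (cmod c)\<^sup>2 * Re (ip y y)" for s :: real
  proof -
    \<comment> \<open>The phase of \<open>cnj c\<close> turns both cross terms into s |c|^2, which
      leaves a real quadratic in s.\<close>
    define k where "k = of_real s * cnj c"
    have "0 \<le> Re (ip (pl x (sc k y)) (pl x (sc k y)))" by (rule ip_pos) auto
    also have "ip (pl x (sc k y)) (pl x (sc k y)) = ip x x + k * c + cnj k * cnj c + cnj k * k * ip y y"
      by (simp add: c2 c_def[symmetric] algebra_simps)
    also have "\<dots> = ip x x + 2 * of_real s * (c * cnj c) + of_real s ^2 * (c * cnj c) * ip y y"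
      by (simp add: k_def algebra_simps power2_eq_square)
    finally show ?thesis
      by (simp add: complex_norm_square[symmetric] del: of_real_power)
  qed
  have "(cmod c)\<^sup>2 \<le> Re (ip x x) * Re (ip y y)"
  proof (cases "Re (ip y y) = 0")
    case True
    have "cmod c = 0"
    proof (rule ccontr)
      assume "cmod c \<noteq> 0"
      \<comment> \<open>In the degenerate case the quadratic is affine in s, and this s would give
        it the value -1.\<close>
      then have "2 * (- (Re (ip x x) + 1) / (2 * (cmod c)\<^sup>2)) * (cmod c)\<^sup>2 = - (Re (ip x x) + 1)"
        by (simp add: field_simps)
      with key[of "- (Re (ip x x) + 1) / (2 * (cmod c)\<^sup>2)"] True show False by simp
    qed
    then show ?thesis using True by simp
  next
    case False
    then have p: "Re (ip y y) > 0" using ip_pos[of y] by simp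
    have "0 \<le> Re (ip x x) - (cmod c)\<^sup>2 / Re (ip y y)"
      using key[of "- 1 / Re (ip y y)"] p by (simp add: power2_eq_square field_simps)
    then show ?thesis using p by (simp add: field_simps)
  qed
  then have "cmod c \<le> sqrt (Re (ip x x) * Re (ip y y))" by (rule real_le_rsqrt)
  then show ?thesis by (simp add: c_def nrm_def real_sqrt_mult)
qed

lemma nrm_pl:
  assumes [simp]: "x \<in> H" "y \<in> H"
  shows "nrm (pl x y) \<le> nrm x + nrm y"
proof (rule power2_le_imp_le)
  have "(nrm (pl x y))\<^sup>2 = (nrm x)\<^sup>2 + 2 * Re (ip x y) + (nrm y)\<^sup>2"
    using Re_ip_commute[of x y] by (simp add: nrm_sq)
  also have "\<dots> \<le> (nrm x)\<^sup>2 + 2 * (nrm x * nrm y) + (nrm y)\<^sup>2"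
    using cauchy_schwarz[of x y] complex_Re_le_cmod[of "ip x y"] by simp
  finally show "(nrm (pl x y))\<^sup>2 \<le> (nrm x + nrm y)\<^sup>2" by (simp add: power2_sum)
qed simp

text \<open>The form may be degenerate and no vector space laws are assumed, so rearrangements such
  as x - z = (x - y) + (y - z) are available only up to vectors that the form cannot distinguish.
  That suffices for norms.\<close>

lemma nrm_cong: "x \<in> H \<Longrightarrow> y \<in> H \<Longrightarrow> (\<And>z. z \<in> H \<Longrightarrow> ip z x = ip z y) \<Longrightarrow> nrm x = nrm y"
  unfolding nrm_def by (metis ip_cnj)

lemma nrm_dif_commute: "x \<in> H \<Longrightarrow> y \<in> H \<Longrightarrow> nrm (dif x y) = nrm (dif y x)"
  by (simp add: nrm_def algebra_simps)

lemma nrm_dif_triangle: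
  assumes [simp]: "x \<in> H" "y \<in> H" "z \<in> H"
  shows "nrm (dif x z) \<le> nrm (dif x y) + nrm (dif y z)"
proof -
  have "nrm (dif x z) = nrm (pl (dif x y) (dif y z))" by (rule nrm_cong) auto
  then show ?thesis using nrm_pl[of "dif x y" "dif y z"] by simp
qed

lemma nrm_le_dif:
  assumes [simp]: "x \<in> H" "y \<in> H"
  shows "nrm x \<le> nrm (dif x y) + nrm y"
proof -
  have "nrm x = nrm (pl (dif x y) y)" by (rule nrm_cong) auto
  then show ?thesis using nrm_pl[of "dif x y" y] by simp
qed

lemma nrm_sc: "x \<in> H \<Longrightarrow> nrm (sc c x) = cmod c * nrm x"
proof -
  assume [simp]: "x \<in> H"
  have "Re (ip (sc c x) (sc c x)) = (cmod c)\<^sup>2 * Re (ip x x)"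
    by (simp add: Im_ip_self cmod_power2) (simp add: power2_eq_square algebra_simps)
  then show ?thesis by (simp add: nrm_def real_sqrt_mult)
qed

definition tends :: "(nat \<Rightarrow> 'h) \<Rightarrow> 'h \<Rightarrow> bool" where
  "tends X x \<longleftrightarrow> (\<lambda>n. nrm (dif (X n) x)) \<longlonglongrightarrow> 0"

text \<open>Only differences and the norms of the limits x and y occur on the right, so the bound
  tends to 0 without a separate boundedness argument for the varying vectors.\<close>

lemma ip_diff_bound:
  assumes [simp]: "x \<in> H" "y \<in> H" "x' \<in> H" "y' \<in> H"
  shows "cmod (ip x' y' - ip x y) \<le> nrm (dif x' x) * (nrm (dif y' y) + nrm y) + nrm x * nrm (dif y' y)"
proof -
  have "ip x' y' - ip x y = ip (dif x' x) y' + ip x (dif y' y)" by simp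
  then have "cmod (ip x' y' - ip x y) \<le> cmod (ip (dif x' x) y') + cmod (ip x (dif y' y))"
    by (metis norm_triangle_ineq)
  also have "\<dots> \<le> nrm (dif x' x) * nrm y' + nrm x * nrm (dif y' y)"
    by (intro add_mono cauchy_schwarz) auto
  also have "\<dots> \<le> nrm (dif x' x) * (nrm (dif y' y) + nrm y) + nrm x * nrm (dif y' y)"
    by (intro add_mono mult_left_mono nrm_le_dif) auto
  finally show ?thesis .
qed

lemma tends_ip:
  assumes "tends X x" "tends Y y" "\<And>n. X n \<in> H" "\<And>n. Y n \<in> H" "x \<in> H" "y \<in> H"
  shows "(\<lambda>n. ip (X n) (Y n)) \<longlonglongrightarrow> ip x y"
proof -
  have "(\<lambda>n. nrm (dif (X n) x) * (nrm (dif (Y n) y) + nrm y) + nrm x * nrm (dif (Y n) y)) \<longlonglongrightarrow>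
     0 * (0 + nrm y) + nrm x * 0"
    using assms(1,2) unfolding tends_def by (intro tendsto_intros)
  then have "(\<lambda>n. ip (X n) (Y n) - ip x y) \<longlonglongrightarrow> 0"
    by (rule Lim_null_comparison[rotated, OF tendsto_eq_rhs]) (use ip_diff_bound assms in auto)
  then show ?thesis by (simp add: LIM_zero_iff)
qed

lemma tends_const: "x \<in> H \<Longrightarrow> tends (\<lambda>_. x) x"
  by (simp add: tends_def nrm_def)

lemma tends_ip_right:
  "tends Y y \<Longrightarrow> (\<And>n. Y n \<in> H) \<Longrightarrow> y \<in> H \<Longrightarrow> x \<in> H \<Longrightarrow> (\<lambda>n. ip x (Y n)) \<longlonglongrightarrow> ip x y"
  using tends_ip[OF tends_const] by blast

end

text \<open>\<open>ip_ext\<close> stands in for the vector space laws: two vectors are equal once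
  they have the same inner product with every test vector.\<close>

locale hilb = semi_ip +
  fixes zr
  assumes zr_closed [simp]: "zr \<in> H"
    and ip_zr [simp]: "x \<in> H \<Longrightarrow> ip x zr = 0"
    and ip_ext: "x \<in> H \<Longrightarrow> y \<in> H \<Longrightarrow> (\<And>z. z \<in> H \<Longrightarrow> ip z x = ip z y) \<Longrightarrow> x = y"
    and complete: "(\<And>n. X n \<in> H) \<Longrightarrow>
       (\<And>e. e > 0 \<Longrightarrow> \<exists>N. \<forall>m\<ge>N. \<forall>n\<ge>N. nrm (dif (X m) (X n)) < e) \<Longrightarrow> \<exists>x\<in>H. tends X x"
begin

lemma tends_unique:
  assumes "tends X x" "tends X y" "\<And>n. X n \<in> H" "x \<in> H" "y \<in> H"
  shows "x = y"
  using assms by (intro ip_ext) (metis LIMSEQ_unique tends_ip_right)+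

text \<open>The representing vector minimises the strictly convex functional x -> |x|^2 - 2 Re phi(x);
  the parallelogram law makes every minimising sequence Cauchy.\<close>
lemma riesz:
  fixes \<phi> :: "'a \<Rightarrow> complex"
  assumes add: "\<And>x y. x \<in> H \<Longrightarrow> y \<in> H \<Longrightarrow> \<phi> (pl x y) = \<phi> x + \<phi> y"
    and scl: "\<And>c x. x \<in> H \<Longrightarrow> \<phi> (sc c x) = cnj c * \<phi> x"
    and bd: "\<And>x. x \<in> H \<Longrightarrow> cmod (\<phi> x) \<le> C * nrm x"
  shows "\<exists>y\<in>H. \<forall>x\<in>H. \<phi> x = ip x y"
proof -
  define J where "J x = Re (ip x x) - 2 * Re (\<phi> x)" for x
  have Jlow: "J x \<ge> - C\<^sup>2" if "x \<in> H" for x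
  proof -
    have "Re (\<phi> x) \<le> C * nrm x" using bd[OF that] complex_Re_le_cmod[of "\<phi> x"] by linarith
    then have "J x \<ge> (nrm x)\<^sup>2 - 2 * C * nrm x" unfolding J_def nrm_sq[OF that] by simp
    moreover have "(nrm x)\<^sup>2 - 2 * C * nrm x + C\<^sup>2 \<ge> 0"
      using zero_le_power2[of "nrm x - C"] by (simp add: power2_diff algebra_simps)
    ultimately show ?thesis by linarith
  qed
  define m where "m = Inf (J ` H)"
  have bdd: "bdd_below (J ` H)" using Jlow by (auto intro!: bdd_belowI)
  have mle: "m \<le> J x" if "x \<in> H" for x unfolding m_def using bdd that by (simp add: cInf_lower)
  have ex: "\<exists>x\<in>H. J x < m + e" if "e > 0" for e
  proof -
    have "Inf (J ` H) < m + e" using that by (simp add: m_def)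
    then show ?thesis using cInf_lessD[of "J ` H" "m + e"] zr_closed by blast
  qed
  then have "\<forall>n. \<exists>x\<in>H. J x < m + 1 / Suc n" by simp
  then obtain X where X: "\<And>n. X n \<in> H" "\<And>n. J (X n) < m + 1 / Suc n" by metis
  have par: "(nrm (dif x y))\<^sup>2 = 2 * J x + 2 * J y - 4 * J (sc (1/2) (pl x y))"
    if [simp]: "x \<in> H" "y \<in> H" for x y
    using Re_ip_commute[of x y]
    by (simp add: nrm_sq J_def add scl algebra_simps)
  have "\<exists>N. \<forall>k\<ge>N. \<forall>n\<ge>N. nrm (dif (X k) (X n)) < e" if "e > 0" for e
  proof -
    have "e\<^sup>2 / 4 > 0" using that by simp
    then obtain N where N: "1 / Suc N < e\<^sup>2 / 4" by (rule nat_approx_posE)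
    show ?thesis
    proof (intro exI allI impI)
      fix k n assume "k \<ge> N" "n \<ge> N"
      then have "1 / Suc k \<le> 1 / Suc N" "1 / Suc n \<le> 1 / Suc N" by (simp_all add: field_simps)
      then have "J (X k) < m + e\<^sup>2/4" "J (X n) < m + e\<^sup>2/4" using X(2)[of k] X(2)[of n] N by linarith+
      moreover have "m \<le> J (sc (1/2) (pl (X k) (X n)))" by (intro mle) (simp add: X)
      ultimately have "(nrm (dif (X k) (X n)))\<^sup>2 < e\<^sup>2" unfolding par[OF X(1) X(1)] by linarith
      then show "nrm (dif (X k) (X n)) < e" using that by (simp add: power2_less_imp_less)
    qed
  qed
  then obtain y where y: "y \<in> H" "tends X y" using complete[of X] X(1) by blast
  have "\<phi> x = ip x y" if [simp]: "x \<in> H" for x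
  proof -
    have reeq: "Re (\<phi> x) = Re (ip x y)" if [simp]: "x \<in> H" for x
    proof -
      define D where "D = Re (ip x y) - Re (\<phi> x)"
      \<comment> \<open>First variation of \<open>J\<close> at y in direction x: a move by s x along
        the minimising sequence cannot go below the infimum m.\<close>
      have "0 \<le> 2 * s * D + s\<^sup>2 * Re (ip x x)" for s :: real
      proof -
        have "m \<le> J (X n) + 2 * s * (Re (ip x (X n)) - Re (\<phi> x)) + s\<^sup>2 * Re (ip x x)" for n
        proof -
          have "m \<le> J (pl (X n) (sc (of_real s) x))" by (rule mle) (simp add: X)
          also have "\<dots> = J (X n) + 2 * s * (Re (ip x (X n)) - Re (\<phi> x)) + s\<^sup>2 * Re (ip x x)"
            using Re_ip_commute[of x "X n"] X(1)[of n]
            by (simp add: J_def add scl algebra_simps power2_eq_square)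
          finally show ?thesis .
        qed
        then have le: "0 \<le> 1 / Suc n + 2 * s * (Re (ip x (X n)) - Re (\<phi> x)) + s\<^sup>2 * Re (ip x x)" for n
          using X(2)[of n] by (smt (verit))
        have "(\<lambda>n. 1 / Suc n + 2 * s * (Re (ip x (X n)) - Re (\<phi> x)) + s\<^sup>2 * Re (ip x x))
           \<longlonglongrightarrow> 0 + 2 * s * D + s\<^sup>2 * Re (ip x x)"
          unfolding D_def using tends_ip_right[OF y(2) X(1) y(1) that]
          by (intro tendsto_intros LIMSEQ_Suc[OF lim_1_over_n])
        then show ?thesis using le by (intro LIMSEQ_le_const) auto
      qed
      note q = this
      have "D = 0"
      proof (rule ccontr)
        assume "D \<noteq> 0"
        define N where "N = Re (ip x x) + 1"
        have N: "N > 0" using ip_pos[of x] by (simp add: N_def)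
        \<comment> \<open>The value s = -D / N makes the quadratic negative, since N exceeds
          \<open>Re (ip x x)\<close>.\<close>
        have "2 * (- D / N) * D + (- D / N)\<^sup>2 * Re (ip x x) = (D\<^sup>2 / N\<^sup>2) * (Re (ip x x) - 2 * N)"
          using N by (simp add: field_simps power2_eq_square)
        moreover have "(D\<^sup>2 / N\<^sup>2) * (Re (ip x x) - 2 * N) < 0"
          using N \<open>D \<noteq> 0\<close> ip_pos[of x] by (intro mult_pos_neg) (auto simp: N_def)
        ultimately show False using q[of "- D / N"] by linarith
      qed
      then show ?thesis by (simp add: D_def)
    qed
    have "Re (\<phi> x) = Re (ip x y)" by (rule reeq) simp
    \<comment> \<open>Both sides are antilinear in x, so the real part at i x is the imaginary part
      at x.\<close>
    moreover have "Re (\<phi> (sc \<i> x)) = Re (ip (sc \<i> x) y)" by (rule reeq) simp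
    then have "Im (\<phi> x) = Im (ip x y)" using y(1) by (simp add: scl)
    ultimately show ?thesis by (simp add: complex_eq_iff)
  qed
  then show ?thesis using y(1) by blast
qed

end

subsection \<open>Positivity on the unit interval via Bernstein bases\<close>

text \<open>The ratio is the product of (i - j) / (n - j) over j < k. Each factor differs from i / n
  by at most d / (n - d), and the partial products lie in [0,1], so exchanging the factors one at a
  time costs k such errors.\<close>

lemma Bernstein_binomial_ratio:
  fixes i k n d :: nat
  assumes "i \<le> n" "k \<le> d" "d < n"
  shows "\<bar>real (i choose k) / real (n choose k) - (real i / real n) ^ k\<bar> \<le> k * (d / (real n - d))"
  using assms(2)
proof (induction k)
  case 0
  then show ?case by simp
next
  case (Suc k)
  define A where "A j = real (i choose j) / real (n choose j)" for j
  define u where "u = real i / real n"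
  define v where "v = (real i - k) / (real n - k)"
  have kn: "k < n" using Suc.prems assms(3) by simp
  have rec: "real (Suc k) * real (m choose Suc k) = (real m - k) * real (m choose k)" for m
    using gbinomial_mult_1[of "real m" k] by (simp add: binomial_gbinomial algebra_simps)
  have A: "A (Suc k) = A k * v"
  proof -
    have nz: "real (n choose Suc k) > 0" "real (n choose k) > 0" "real n - k > 0"
      using kn by (auto)
    have "A (Suc k) = (real (Suc k) * real (i choose Suc k)) / (real (Suc k) * real (n choose Suc k))"
      by (simp add: A_def del: of_nat_Suc)
    also have "\<dots> = A k * v" unfolding rec A_def v_def by (simp add: mult.commute)
    finally show ?thesis .
  qed
  have u: "0 \<le> u" "u \<le> 1" using assms by (auto simp: u_def)
  have A01: "0 \<le> A k" "A k \<le> 1"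
    using binomial_right_mono[OF assms(1)] kn by (auto simp: A_def divide_le_eq_1)
  have IH: "\<bar>A k - u ^ k\<bar> \<le> k * (d / (real n - d))" using Suc by (simp add: A_def u_def)
  have uv: "\<bar>v - u\<bar> \<le> d / (real n - d)"
  proof -
    have "u - v = (k / (real n - k)) * ((real n - real i) / real n)"
      using kn by (simp add: u_def v_def field_simps)
    moreover have "0 \<le> (real n - real i) / real n" "(real n - real i) / real n \<le> 1"
      using assms by (auto simp: field_simps)
    moreover have "0 \<le> k / (real n - k)" using kn by simp
    ultimately have "0 \<le> u - v" "u - v \<le> k / (real n - k)"
      by (metis mult_nonneg_nonneg, metis mult_left_le)
    then have "\<bar>v - u\<bar> \<le> k / (real n - k)" by simp
    also have "\<dots> \<le> d / (real n - d)" using Suc.prems assms(3) by (intro frac_le) auto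
    finally show ?thesis .
  qed
  have "A (Suc k) - u ^ Suc k = A k * (v - u) + (A k - u ^ k) * u" by (simp add: A algebra_simps)
  then have "\<bar>A (Suc k) - u ^ Suc k\<bar> \<le> \<bar>A k * (v - u)\<bar> + \<bar>(A k - u ^ k) * u\<bar>" by (metis abs_triangle_ineq)
  also have "\<dots> \<le> 1 * (d / (real n - d)) + k * (d / (real n - d)) * 1"
    unfolding abs_mult using A01 u uv IH by (intro add_mono mult_mono) auto
  finally show ?case by (simp add: A_def u_def algebra_simps add_divide_distrib)
qed

text \<open>X^k is multiplied by (X + Y)^(n - k) = 1 and expanded. The identity is one of
  polynomials rather than of values on [0,1], so it may be used under a linear functional.\<close>

lemma X_power_Bernstein:
  fixes X Y :: "real poly"
  assumes XY: "X + Y = 1" and "k \<le> n"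
  shows "X ^ k = (\<Sum>i\<le>n. smult (real (i choose k) / real (n choose k)) (smult (real (n choose i)) (X ^ i * Y ^ (n - i))))"
proof -
  have "X ^ k = X ^ k * (X + Y) ^ (n - k)" by (simp add: XY)
  also have "\<dots> = (\<Sum>j\<le>n-k. smult (real ((n-k) choose j)) (X ^ (k+j) * Y ^ (n - (k + j))))"
    unfolding binomial_ring by (simp add: sum_distrib_left power_add mult_ac of_nat_poly)
  also have "\<dots> = (\<Sum>i\<in>{k..n}. smult (real ((n-k) choose (i-k))) (X ^ i * Y ^ (n - i)))"
    using assms(2) by (intro sum.reindex_bij_witness[of _ "\<lambda>i. i - k" "\<lambda>j. k + j"]) auto
  also have "\<dots> = (\<Sum>i\<in>{k..n}. smult (real (i choose k) / real (n choose k)) (smult (real (n choose i)) (X ^ i * Y ^ (n - i))))"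
  proof (rule sum.cong[OF refl])
    fix i assume i: "i \<in> {k..n}"
    then have "(n choose i) * (i choose k) = (n choose k) * ((n - k) choose (i - k))"
      by (intro choose_mult) auto
    then have "real (n choose i) * real (i choose k) = real (n choose k) * real ((n - k) choose (i - k))"
      by (metis of_nat_mult)
    then have "real ((n - k) choose (i - k)) = real (i choose k) / real (n choose k) * real (n choose i)"
      using i by (simp add: field_simps)
    then show "smult (real ((n-k) choose (i-k))) (X ^ i * Y ^ (n - i)) =
      smult (real (i choose k) / real (n choose k)) (smult (real (n choose i)) (X ^ i * Y ^ (n - i)))" by simp
  qed
  also have "\<dots> = (\<Sum>i\<le>n. smult (real (i choose k) / real (n choose k)) (smult (real (n choose i)) (X ^ i * Y ^ (n - i))))"
    by (intro sum.mono_neutral_left) (auto simp: not_le)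
  finally show ?thesis .
qed

text \<open>In the Bernstein basis of degree n the i-th coefficient of g is g(i/n) + O(1/n), hence almost
  nonnegative, while the values of L on the basis are nonnegative and sum to L 1.\<close>
lemma poly_functional_nonneg:
  fixes L :: "real poly \<Rightarrow> real"
  assumes add: "\<And>f g. L (f + g) = L f + L g"
    and smult: "\<And>c f. L (smult c f) = c * L f"
    and pos: "\<And>k m. 0 \<le> L ([:0,1:] ^ k * [:1,-1:] ^ m)"
    and g: "\<And>x. 0 \<le> x \<Longrightarrow> x \<le> 1 \<Longrightarrow> 0 \<le> poly g x"
  shows "0 \<le> L g"
proof -
  define X Y :: "real poly" where "X = [:0,1:]" and "Y = [:1,-1:]"
  have XY: "X + Y = 1" by (simp add: X_def Y_def one_pCons)
  have L0: "L 0 = 0" using smult[of 0 0] by simp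
  have Lsum: "L (sum f A) = (\<Sum>i\<in>A. L (f i))" for f and A :: "nat set"
    by (induction A rule: infinite_finite_induct) (auto simp: L0 add)
  define d where "d = degree g"
  have gX: "g = (\<Sum>k\<le>d. smult (coeff g k) (X ^ k))"
    unfolding d_def X_def using poly_as_sum_of_monoms[of g] by (simp add: monom_altdef)
  \<comment> \<open>K / (n - d) bounds the deviation of the i-th Bernstein coefficient of g from
    g(i/n), uniformly in i.\<close>
  define K where "K = (\<Sum>k\<le>d. \<bar>coeff g k\<bar> * (k * d))"
  have lower: "- (K / (real n - d)) * L 1 \<le> L g" if n: "d < n" for n
  proof -
    define w where "w i = L (smult (real (n choose i)) (X ^ i * Y ^ (n - i)))" for i
    have w: "w i \<ge> 0" for i unfolding w_def smult X_def Y_def by (intro mult_nonneg_nonneg pos) simp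
    have exp: "L (X ^ k) = (\<Sum>i\<le>n. real (i choose k) / real (n choose k) * w i)" if "k \<le> d" for k
      using that n by (subst X_power_Bernstein[OF XY, of k n]) (simp_all add: Lsum smult w_def mult.assoc)
    have w1: "(\<Sum>i\<le>n. w i) = L 1" using exp[of 0] by simp
    have "L g = (\<Sum>k\<le>d. coeff g k * L (X ^ k))"
      by (subst gX) (simp add: Lsum smult)
    also have "\<dots> = (\<Sum>k\<le>d. \<Sum>i\<le>n. coeff g k * (real (i choose k) / real (n choose k)) * w i)"
      by (intro sum.cong) (auto simp: exp sum_distrib_left mult_ac)
    also have "\<dots> = (\<Sum>i\<le>n. (\<Sum>k\<le>d. coeff g k * (real (i choose k) / real (n choose k))) * w i)"
      by (subst sum.swap) (simp add: sum_distrib_right)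
    also have "\<dots> \<ge> (\<Sum>i\<le>n. - (K / (real n - d)) * w i)"
    proof (intro sum_mono mult_right_mono w)
      fix i assume "i \<in> {..n}"
      then have i: "i \<le> n" by simp
      have "poly g (i/n) = (\<Sum>k\<le>d. coeff g k * (i/n) ^ k)" unfolding d_def by (rule poly_altdef)
      then have "\<bar>poly g (i/n) - (\<Sum>k\<le>d. coeff g k * (real (i choose k) / real (n choose k)))\<bar> =
         \<bar>\<Sum>k\<le>d. coeff g k * ((i/n) ^ k - real (i choose k) / real (n choose k))\<bar>"
        by (simp add: sum_subtractf algebra_simps)
      also have "\<dots> \<le> (\<Sum>k\<le>d. \<bar>coeff g k\<bar> * (k * (d / (real n - d))))"
      proof (rule order_trans[OF sum_abs], intro sum_mono)
        fix k assume "k \<in> {..d}"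
        then show "\<bar>coeff g k * ((i/n) ^ k - real (i choose k) / real (n choose k))\<bar> \<le> \<bar>coeff g k\<bar> * (k * (d / (real n - d)))"
          unfolding abs_mult
          using Bernstein_binomial_ratio[OF i _ n, of k] by (intro mult_left_mono) (auto simp: abs_minus_commute)
      qed
      also have "\<dots> = K / (real n - d)" by (simp add: K_def sum_divide_distrib)
      finally show "- (K / (real n - d)) \<le> (\<Sum>k\<le>d. coeff g k * (real (i choose k) / real (n choose k)))"
        using g[of "i/n"] i n by auto
    qed
    finally show ?thesis unfolding sum_distrib_left[symmetric] w1 .
  qed
  have "filterlim (\<lambda>n. real n - d) at_top sequentially"
    using filterlim_tendsto_add_at_top[OF tendsto_const[of "- real d"] filterlim_real_sequentially] by simp
  then have "(\<lambda>n. - (K / (real n - d)) * L 1) \<longlonglongrightarrow> - 0 * L 1"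
    by (intro tendsto_intros tendsto_divide_0[OF tendsto_const] filterlim_at_top_imp_at_infinity)
  then show ?thesis
    using lower by (intro LIMSEQ_le_const2[of _ 0]) (auto intro!: exI[of _ "Suc d"])
qed

lemma uniform_poly_approx:
  assumes "continuous_on {0..1::real} f"
  shows "\<exists>g :: nat \<Rightarrow> real poly. uniform_limit {0..1} (\<lambda>n. poly (g n)) f sequentially"
proof -
  have "\<exists>g. \<forall>x\<in>{0..1}. \<bar>poly g x - f x\<bar> < e" if e: "e > 0" for e
  proof -
    obtain h where h: "real_polynomial_function h" "\<And>x. x \<in> {0..1} \<Longrightarrow> \<bar>f x - h x\<bar> < e"
      by (rule Stone_Weierstrass_real_polynomial_function[OF compact_Icc assms e]) blast
    then obtain a n where "h = (\<lambda>x. \<Sum>i\<le>n. a i * x ^ i)"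
      using real_polynomial_function_iff_sum by auto
    then have "h = poly (\<Sum>i\<le>n. monom (a i) i)" by (auto simp: poly_sum poly_monom)
    then show ?thesis using h(2) by (metis abs_minus_commute)
  qed
  then have "\<forall>n. \<exists>g. \<forall>x\<in>{0..1}. \<bar>poly g x - f x\<bar> < 1 / Suc n" by simp
  then obtain g where g: "\<And>n x. x \<in> {0..1} \<Longrightarrow> \<bar>poly (g n) x - f x\<bar> < 1 / Suc n" by metis
  have "uniform_limit {0..1} (\<lambda>n. poly (g n)) f sequentially"
  proof (rule uniform_limitI)
    fix e :: real assume "e > 0"
    then obtain N where N: "1 / Suc N < e" using nat_approx_posE by blast
    show "\<forall>\<^sub>F n in sequentially. \<forall>x\<in>{0..1}. dist (poly (g n) x) (f x) < e"
    proof (rule eventually_sequentiallyI[of N], intro ballI)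
      fix n x assume "N \<le> n" "x \<in> {0..1::real}"
      then have "1 / Suc n \<le> 1 / Suc N" by (simp add: field_simps)
      then show "dist (poly (g n) x) (f x) < e"
        using g[OF \<open>x \<in> {0..1}\<close>, of n] N by (simp add: dist_real_def)
    qed
  qed
  then show ?thesis by blast
qed

subsection \<open>Continuous functional calculus of a positive contraction\<close>

text \<open>Function-level forms of the \<open>poly\<close> rules: in a uniform limit
  \<open>poly\<close> stands without its argument, where the pointwise rules do not match.\<close>

lemma poly_mult': "poly (f * g) = (\<lambda>u. poly f u * poly g u)" for f g :: "real poly"
  by auto

lemma poly_add': "poly (f + g) = (\<lambda>u. poly f u + poly g u)" for f g :: "real poly"
  by auto

lemma poly_pcompose': "poly (pcompose f g) = (\<lambda>u. poly f (poly g u))" for f g :: "real poly"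
  by (auto simp: poly_pcompose)

section \<open>Polynomials in a positive contraction\<close>

locale hilb_op = hilb +
  fixes T
  assumes T_closed [simp]: "x \<in> H \<Longrightarrow> T x \<in> H"
    and T_sym: "x \<in> H \<Longrightarrow> y \<in> H \<Longrightarrow> ip (T x) y = ip x (T y)"
    and T_pos: "x \<in> H \<Longrightarrow> 0 \<le> Re (ip x (T x))"
    and T_le: "x \<in> H \<Longrightarrow> Re (ip x (T x)) \<le> Re (ip x x)"
begin

text \<open>Linearity follows from symmetry: T moves to the test vector, where the inner product is
  already linear in the other argument.\<close>

lemma T_pl: "x \<in> H \<Longrightarrow> y \<in> H \<Longrightarrow> T (pl x y) = pl (T x) (T y)"
  by (rule ip_ext) (simp_all flip: T_sym)

lemma T_sc: "x \<in> H \<Longrightarrow> T (sc c x) = sc c (T x)"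
  by (rule ip_ext) (simp_all flip: T_sym)

lemma T_zr: "T zr = zr"
  by (rule ip_ext) (simp_all flip: T_sym)

lemma ip_T_dif: "x \<in> H \<Longrightarrow> y \<in> H \<Longrightarrow> z \<in> H \<Longrightarrow> ip z (T (dif x y)) = ip z (T x) - ip z (T y)"
  by (simp add: dif_def T_pl T_sc)

text \<open>The Horner scheme of \<open>polyop\<close>, with the same \<open>foldr\<close>, so that
  the two agree by unfolding.\<close>

definition pop :: "real poly \<Rightarrow> 'a \<Rightarrow> 'a" where
  "pop g x = foldr (\<lambda>c acc. pl (sc (complex_of_real c) x) (T acc)) (coeffs g) zr"

lemma pop_0 [simp]: "pop 0 x = zr"
  by (simp add: pop_def)

lemma pop_pCons: "x \<in> H \<Longrightarrow> pop (pCons c g) x = pl (sc (of_real c) x) (T (pop g x))"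
\<comment> \<open>\<open>pCons 0 0\<close> has no coefficients at all, so the Horner step is then
  not performed and T zr = zr is needed.\<close>
proof (cases "c = 0 \<and> g = 0")
  case True
  assume "x \<in> H"
  then show ?thesis using True by (intro ip_ext) (auto simp: T_zr)
qed (auto simp: pop_def cCons_def)

lemma pop_closed [simp]: "x \<in> H \<Longrightarrow> pop g x \<in> H"
  by (induction g) (auto simp: pop_pCons)

lemma ip_pop_pCons: "x \<in> H \<Longrightarrow> z \<in> H \<Longrightarrow> ip z (pop (pCons c g) x) = of_real c * ip z x + ip z (T (pop g x))"
  by (simp add: pop_pCons)

lemma ip_pop_add: "x \<in> H \<Longrightarrow> z \<in> H \<Longrightarrow> ip z (pop (f + g) x) = ip z (pop f x) + ip z (pop g x)"
proof (induction f g arbitrary: z rule: poly_induct2)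
  case (pCons a f b g)
  \<comment> \<open>The T in front of the Horner tail is moved to the test vector, hence the
    induction over arbitrary z.\<close>
  from pCons.IH[of "T z"] pCons.prems show ?case
    by (simp add: ip_pop_pCons algebra_simps flip: T_sym)
qed simp

lemma ip_pop_smult: "x \<in> H \<Longrightarrow> z \<in> H \<Longrightarrow> ip z (pop (smult c f) x) = of_real c * ip z (pop f x)"
proof (induction f arbitrary: z)
  case (pCons a f)
  from pCons.IH[of "T z"] pCons.prems show ?case
    by (simp add: ip_pop_pCons algebra_simps flip: T_sym)
qed simp

lemma ip_pop_diff: "x \<in> H \<Longrightarrow> z \<in> H \<Longrightarrow> ip z (pop (f - g) x) = ip z (pop f x) - ip z (pop g x)"
  using ip_pop_add[of x z f "- g"] ip_pop_smult[of x z "-1" g] by simp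

lemma ip_T_pop_uminus: "x \<in> H \<Longrightarrow> z \<in> H \<Longrightarrow> ip z (T (pop (- g) x)) = - ip z (T (pop g x))"
  using ip_pop_smult[of x "T z" "-1" g] by (simp add: T_sym)

lemma ip_pop_const: "x \<in> H \<Longrightarrow> z \<in> H \<Longrightarrow> ip z (pop [:c:] x) = of_real c * ip z x"
  by (simp add: ip_pop_pCons T_zr)

lemma pop_1 [simp]: "x \<in> H \<Longrightarrow> pop 1 x = x"
  by (rule ip_ext) (auto simp: one_pCons ip_pop_pCons T_zr)

lemma pop_X: "x \<in> H \<Longrightarrow> pop [:0,1:] x = T x"
  by (rule ip_ext) (auto simp: ip_pop_pCons T_zr pop_pCons T_pl T_sc)

lemma T_pop: "x \<in> H \<Longrightarrow> T (pop g x) = pop g (T x)"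
  by (induction g) (auto simp: T_zr pop_pCons T_pl T_sc)

lemma pop_sym: "x \<in> H \<Longrightarrow> y \<in> H \<Longrightarrow> ip (pop g x) y = ip x (pop g y)"
proof (induction g arbitrary: x y)
  case 0
  then show ?case using ip_cnj[of y zr] by simp
next
  case (pCons c g)
  then show ?case by (simp add: pop_pCons T_sym T_pop)
qed

lemma pop_mult: "x \<in> H \<Longrightarrow> pop (f * g) x = pop f (pop g x)"
proof (induction f)
  case (pCons c f)
  show ?case
  proof (rule ip_ext)
    fix z assume "z \<in> H"
    then show "ip z (pop (pCons c f * g) x) = ip z (pop (pCons c f) (pop g x))"
      using pCons by (simp add: ip_pop_add ip_pop_smult ip_pop_pCons)
  qed (use pCons in auto)
qed simp

lemma ip_pop_mult: "x \<in> H \<Longrightarrow> y \<in> H \<Longrightarrow> ip x (pop (f * g) y) = ip (pop f x) (pop g y)"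
  by (simp add: pop_mult pop_sym)

text \<open>With Y = 1 - X, the even parts of both exponents form a square F F, which symmetry
  distributes to the two sides of the inner product. The remaining factor is 1, X, Y or X Y, and X Y
  = X X Y + Y Y X is again built from squares times X or Y.\<close>

lemma pop_Bernstein_nonneg:
  assumes [simp]: "x \<in> H"
  shows "0 \<le> Re (ip x (pop ([:0,1:] ^ k * [:1,-1:] ^ m) x))"
proof -
  let ?X = "[:0,1:] :: real poly" and ?Y = "[:1,-1:] :: real poly"
  have X: "0 \<le> Re (ip y (pop ?X y))" if "y \<in> H" for y using T_pos that by (simp add: pop_X)
  have Y1: "?Y = 1 - ?X" by (simp add: one_pCons)
  have Y: "0 \<le> Re (ip y (pop ?Y y))" if "y \<in> H" for y
    using T_le[OF that] ip_pop_diff[OF that that, of 1 ?X] that unfolding Y1 by (simp add: pop_X)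
  have sq: "ip y (pop (f * f * g) y) = ip (pop f y) (pop g (pop f y))" if "y \<in> H" for y f g
  proof -
    have "f * f * g = f * (g * f)" by (simp add: mult_ac)
    then show ?thesis using ip_pop_mult[of y y f "g * f"] pop_mult[of y g f] that by metis
  qed
  have XYeq: "?X * ?Y = ?X * ?X * ?Y + ?Y * ?Y * ?X" by simp
  have XY: "0 \<le> Re (ip y (pop (?X * ?Y) y))" if "y \<in> H" for y
    using that by (subst XYeq) (simp add: ip_pop_add sq X Y del: mult_pCons_left mult_pCons_right)
  define i j where "i = k div 2" and "j = m div 2"
  define F where "F = ?X ^ i * ?Y ^ j"
  have eq: "?X ^ k * ?Y ^ m = F * F * (?X ^ (k mod 2) * ?Y ^ (m mod 2))"
  proof -
    have "?X ^ k = ?X ^ (i + i + k mod 2)" "?Y ^ m = ?Y ^ (j + j + m mod 2)"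
      unfolding i_def j_def by (rule arg_cong[where f="power _"], presburger)+
    then show ?thesis unfolding F_def power_add by (simp only: mult_ac)
  qed
  have "k mod 2 = 0 \<or> k mod 2 = 1" "m mod 2 = 0 \<or> m mod 2 = 1" by auto
  then have "0 \<le> Re (ip y (pop (?X ^ (k mod 2) * ?Y ^ (m mod 2)) y))" if "y \<in> H" for y
    using X[OF that] Y[OF that] XY[OF that] that
    by (elim disjE) (simp_all add: ip_pos del: mult_pCons_left mult_pCons_right)
  then show ?thesis unfolding eq by (simp add: sq del: mult_pCons_left mult_pCons_right)
qed

text \<open>This plays the part of the spectral theorem: the linear functional g -> Re <x, g(T) x>
  is nonnegative on Bernstein products, hence on every polynomial that is nonnegative on
  [0,1].\<close>

lemma pop_nonneg:
  assumes "x \<in> H" "\<And>u. 0 \<le> u \<Longrightarrow> u \<le> 1 \<Longrightarrow> 0 \<le> poly g u"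
  shows "0 \<le> Re (ip x (pop g x))"
  by (rule poly_functional_nonneg[of "\<lambda>g. Re (ip x (pop g x))", OF _ _ pop_Bernstein_nonneg])
    (use assms in \<open>auto simp: ip_pop_add ip_pop_smult\<close>)

text \<open>The slack e is for polynomial approximants, which respect an inequality between their
  limits only approximately.\<close>

lemma pop_mono_eps:
  assumes "x \<in> H" "\<And>u. 0 \<le> u \<Longrightarrow> u \<le> 1 \<Longrightarrow> poly f u \<le> poly g u + e"
  shows "Re (ip x (pop f x)) \<le> Re (ip x (pop g x)) + e * Re (ip x x)"
  using pop_nonneg[of x "g + [:e:] - f"] assms
  by (simp add: ip_pop_diff ip_pop_add ip_pop_const algebra_simps)

text \<open>The squared norm of g(T) x is <x, (g g)(T) x>, and g g <= e^2 on [0,1].\<close>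

lemma nrm_pop_le:
  assumes "x \<in> H" "\<And>u. 0 \<le> u \<Longrightarrow> u \<le> 1 \<Longrightarrow> \<bar>poly g u\<bar> \<le> e"
  shows "nrm (pop g x) \<le> e * nrm x"
proof (rule power2_le_imp_le)
  have e: "0 \<le> e" using assms(2)[of 0] by simp
  then show "0 \<le> e * nrm x" using assms(1) by simp
  have "(nrm (pop g x))\<^sup>2 = Re (ip x (pop (g * g) x))" using assms(1) by (simp add: nrm_sq ip_pop_mult)
  also have "\<dots> \<le> Re (ip x (pop ([:e\<^sup>2:]) x)) + 0 * Re (ip x x)"
  proof (rule pop_mono_eps)
    fix u :: real assume "0 \<le> u" "u \<le> 1"
    then have "(poly g u)\<^sup>2 \<le> e\<^sup>2" using assms(2)[of u] e by (metis abs_le_square_iff abs_of_nonneg)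
    then show "poly (g * g) u \<le> poly ([:e\<^sup>2:]) u + 0" by (simp add: power2_eq_square)
  qed (rule assms)
  also have "\<dots> = (e * nrm x)\<^sup>2" using assms(1) by (simp add: ip_pop_const nrm_sq power_mult_distrib)
  finally show "(nrm (pop g x))\<^sup>2 \<le> (e * nrm x)\<^sup>2" .
qed

lemma nrm_dif_pop_le:
  assumes "x \<in> H" "\<And>u. 0 \<le> u \<Longrightarrow> u \<le> 1 \<Longrightarrow> \<bar>poly f u - poly g u\<bar> \<le> e"
  shows "nrm (dif (pop f x) (pop g x)) \<le> e * nrm x"
proof -
  have "nrm (dif (pop f x) (pop g x)) = nrm (pop (f - g) x)"
    using assms by (intro nrm_cong) (auto simp: ip_pop_diff)
  then show ?thesis using nrm_pop_le[of x "f - g" e] assms by simp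
qed

section \<open>From polynomials to continuous functions\<close>

abbreviation uconv :: "(nat \<Rightarrow> real poly) \<Rightarrow> (real \<Rightarrow> real) \<Rightarrow> bool" where
  "uconv g f \<equiv> uniform_limit {0..1} (\<lambda>n. poly (g n)) f sequentially"

lemma pop_limit_ex:
  assumes f: "continuous_on {0..1} f" and x: "x \<in> H"
  shows "\<exists>y\<in>H. \<forall>g. uconv g f \<longrightarrow> tends (\<lambda>n. pop (g n) x) y"
proof -
  obtain g0 where g0: "uconv g0 f" using uniform_poly_approx[OF f] by blast
  \<comment> \<open>Used twice: with g = g0 it is the Cauchy property, with general g it shows that
    the limit does not depend on the sequence.\<close>
  have close: "\<exists>N. \<forall>m\<ge>N. \<forall>n\<ge>N. nrm (dif (pop (g m) x) (pop (g0 n) x)) < e"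
    if g: "uconv g f" and e: "e > 0" for g e
  proof -
    define d where "d = e / (2 * (nrm x + 1))"
    have nx: "nrm x + 1 > 0" using x nrm_nonneg[of x] by linarith
    have d: "d > 0" using e nx by (simp add: d_def)
    obtain N1 where N1: "\<And>n u. n \<ge> N1 \<Longrightarrow> u \<in> {0..1} \<Longrightarrow> dist (poly (g n) u) (f u) < d"
      using uniform_limitD[OF g d] unfolding eventually_sequentially by blast
    obtain N2 where N2: "\<And>n u. n \<ge> N2 \<Longrightarrow> u \<in> {0..1} \<Longrightarrow> dist (poly (g0 n) u) (f u) < d"
      using uniform_limitD[OF g0 d] unfolding eventually_sequentially by blast
    have "nrm (dif (pop (g m) x) (pop (g0 n) x)) < e" if "m \<ge> max N1 N2" "n \<ge> max N1 N2" for m n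
    proof -
      have "nrm (dif (pop (g m) x) (pop (g0 n) x)) \<le> (2 * d) * nrm x"
      proof (rule nrm_dif_pop_le[OF x])
        fix u :: real assume "0 \<le> u" "u \<le> 1"
        then show "\<bar>poly (g m) u - poly (g0 n) u\<bar> \<le> 2 * d"
          using N1[of m u] N2[of n u] that by (simp add: dist_real_def)
      qed
      also have "\<dots> < 2 * d * (nrm x + 1)" using d by simp
      also have "\<dots> = e" using nx by (simp add: d_def field_simps)
      finally show ?thesis .
    qed
    then show ?thesis by blast
  qed
  obtain y where y: "y \<in> H" "tends (\<lambda>n. pop (g0 n) x) y"
    using complete[of "\<lambda>n. pop (g0 n) x"] close[OF g0] x by auto
  have "tends (\<lambda>n. pop (g n) x) y" if g: "uconv g f" for g
  proof -
    have "(\<lambda>n. nrm (dif (pop (g n) x) (pop (g0 n) x))) \<longlonglongrightarrow> 0"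
    proof (rule LIMSEQ_I)
      fix e :: real assume "e > 0"
      from close[OF g this] show "\<exists>N. \<forall>n\<ge>N. norm (nrm (dif (pop (g n) x) (pop (g0 n) x)) - 0) < e"
        using x by auto
    qed
    then have "(\<lambda>n. nrm (dif (pop (g n) x) (pop (g0 n) x)) + nrm (dif (pop (g0 n) x) y)) \<longlonglongrightarrow> 0 + 0"
      using y unfolding tends_def by (intro tendsto_add)
    then have lim: "(\<lambda>n. nrm (dif (pop (g n) x) (pop (g0 n) x)) + nrm (dif (pop (g0 n) x) y)) \<longlonglongrightarrow> 0" by simp
    show ?thesis unfolding tends_def
      by (rule Lim_null_comparison[OF _ lim]) (use x y in \<open>auto intro!: always_eventually nrm_dif_triangle\<close>)
  qed
  then show ?thesis using y by blast
qed

text \<open>One vector serves all approximating sequences at once, as \<open>opfun\<close> demands;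
  \<open>opfun_eq\<close> identifies the two.\<close>

definition fc :: "(real \<Rightarrow> real) \<Rightarrow> 'a \<Rightarrow> 'a" where
  "fc f x = (SOME y. y \<in> H \<and> (\<forall>g. uconv g f \<longrightarrow> tends (\<lambda>n. pop (g n) x) y))"

lemma
  assumes "continuous_on {0..1} f" "x \<in> H"
  shows fc_closed [simp]: "fc f x \<in> H"
    and fc_tends: "uconv g f \<Longrightarrow> tends (\<lambda>n. pop (g n) x) (fc f x)"
proof -
  have "\<exists>y. y \<in> H \<and> (\<forall>g. uconv g f \<longrightarrow> tends (\<lambda>n. pop (g n) x) y)"
    using pop_limit_ex[OF assms] by blast
  then have "fc f x \<in> H \<and> (\<forall>g. uconv g f \<longrightarrow> tends (\<lambda>n. pop (g n) x) (fc f x))"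
    unfolding fc_def by (rule someI_ex)
  then show "fc f x \<in> H" "uconv g f \<Longrightarrow> tends (\<lambda>n. pop (g n) x) (fc f x)" by auto
qed

lemma fc_unique:
  assumes "uconv g f" "continuous_on {0..1} f" "x \<in> H" "y \<in> H" "tends (\<lambda>n. pop (g n) x) y"
  shows "y = fc f x"
  by (rule tends_unique[OF assms(5) fc_tends[OF assms(2,3,1)]]) (use assms in simp_all)

lemma fc_ip_lim:
  assumes "uconv g f" "continuous_on {0..1} f" "x \<in> H" "z \<in> H"
  shows "(\<lambda>n. ip z (pop (g n) x)) \<longlonglongrightarrow> ip z (fc f x)"
  by (rule tends_ip_right[OF fc_tends[OF assms(2,3,1)]]) (use assms in simp_all)

lemma fc_cong:
  assumes "\<And>u. 0 \<le> u \<Longrightarrow> u \<le> 1 \<Longrightarrow> f u = g u"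
  shows "fc f x = fc g x"
proof -
  have "uconv h f \<longleftrightarrow> uconv h g" for h using assms by (simp add: uniform_limit_iff)
  then show ?thesis by (simp add: fc_def)
qed

lemma fc_poly: "x \<in> H \<Longrightarrow> fc (poly g) x = pop g x"
  by (rule fc_unique[symmetric, of "\<lambda>_. g"])
    (simp_all add: tends_const continuous_on_poly continuous_on_id uniform_limit_iff)

lemma fc_sym:
  assumes f: "continuous_on {0..1} f" and [simp]: "x \<in> H" "y \<in> H"
  shows "ip (fc f x) y = ip x (fc f y)"
proof -
  obtain g where g: "uconv g f" using uniform_poly_approx[OF f] by blast
  have "(\<lambda>n. ip (pop (g n) x) y) \<longlonglongrightarrow> ip (fc f x) y"
    using f g by (intro tends_ip fc_tends tends_const) auto
  then have "(\<lambda>n. ip x (pop (g n) y)) \<longlonglongrightarrow> ip (fc f x) y" by (simp add: pop_sym)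
  then show ?thesis using fc_ip_lim[OF g f, of y x] LIMSEQ_unique by auto
qed

text \<open>Tested weakly: symmetry puts f(T) on the test vector, and then both arguments of the
  inner product converge in norm.\<close>

lemma fc_mult:
  assumes f: "continuous_on {0..1} f" and h: "continuous_on {0..1} h" and [simp]: "x \<in> H"
  shows "fc f (fc h x) = fc (\<lambda>u. f u * h u) x"
proof (rule ip_ext)
  have fh: "continuous_on {0..1} (\<lambda>u. f u * h u)" by (intro continuous_intros f h)
  then show "fc f (fc h x) \<in> H" "fc (\<lambda>u. f u * h u) x \<in> H" using f h by auto
  fix z assume [simp]: "z \<in> H"
  obtain g where g: "uconv g f" using uniform_poly_approx[OF f] by blast
  obtain k where k: "uconv k h" using uniform_poly_approx[OF h] by blast
  have "bounded (f ` {0..1})" "bounded (h ` {0..1})"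
    using f h by (auto intro!: compact_imp_bounded compact_continuous_image)
  then have "uniform_limit {0..1} (\<lambda>n u. poly (g n) u * poly (k n) u) (\<lambda>u. f u * h u) sequentially"
    by (intro uniform_lim_mult g k)
  then have gk: "uconv (\<lambda>n. g n * k n) (\<lambda>u. f u * h u)" by (simp add: poly_mult')
  have "(\<lambda>n. ip (pop (g n) z) (pop (k n) x)) \<longlonglongrightarrow> ip (fc f z) (fc h x)"
    using f h g k by (intro tends_ip fc_tends) auto
  moreover have "(\<lambda>n. ip (pop (g n) z) (pop (k n) x)) \<longlonglongrightarrow> ip z (fc (\<lambda>u. f u * h u) x)"
    using fc_ip_lim[OF gk fh, of x z] by (simp add: ip_pop_mult)
  ultimately have "ip (fc f z) (fc h x) = ip z (fc (\<lambda>u. f u * h u) x)" by (rule LIMSEQ_unique)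
  then show "ip z (fc f (fc h x)) = ip z (fc (\<lambda>u. f u * h u) x)"
    using fc_sym[OF f, of z "fc h x"] h by simp
qed

lemma ip_fc_add:
  assumes f: "continuous_on {0..1} f" and h: "continuous_on {0..1} h" and [simp]: "x \<in> H" "z \<in> H"
  shows "ip z (fc (\<lambda>u. f u + h u) x) = ip z (fc f x) + ip z (fc h x)"
proof -
  have fh: "continuous_on {0..1} (\<lambda>u. f u + h u)" by (intro continuous_intros f h)
  obtain g where g: "uconv g f" using uniform_poly_approx[OF f] by blast
  obtain k where k: "uconv k h" using uniform_poly_approx[OF h] by blast
  have "uniform_limit {0..1} (\<lambda>n u. poly (g n) u + poly (k n) u) (\<lambda>u. f u + h u) sequentially"
    by (intro uniform_limit_add g k)
  then have gk: "uconv (\<lambda>n. g n + k n) (\<lambda>u. f u + h u)" by (simp add: poly_add')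
  have "(\<lambda>n. ip z (pop (g n) x) + ip z (pop (k n) x)) \<longlonglongrightarrow> ip z (fc f x) + ip z (fc h x)"
    using f h g k by (intro tendsto_add fc_ip_lim) auto
  then show ?thesis using fc_ip_lim[OF gk fh, of x z] LIMSEQ_unique by (auto simp: ip_pop_add)
qed

lemma fc_scale:
  assumes "continuous_on {0..1} f" "x \<in> H"
  shows "fc (\<lambda>u. c * f u) x = sc (of_real c) (fc f x)"
proof -
  \<comment> \<open>The constant is read as a polynomial, which makes this a case of
    \<open>fc_mult\<close>.\<close>
  have c: "(\<lambda>u. c * f u) = (\<lambda>u. poly [:c:] u * f u)" by simp
  have "fc (\<lambda>u. c * f u) x = pop [:c:] (fc f x)"
    unfolding c using assms by (subst fc_mult[symmetric]) (auto intro!: continuous_intros simp: fc_poly simp del: poly_pCons)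
  then show ?thesis
    using assms by (intro ip_ext) (auto simp: ip_pop_pCons T_zr)
qed

lemma ip_fc_sum:
  assumes "finite J" "\<And>j. j \<in> J \<Longrightarrow> continuous_on {0..1} (f j)" and [simp]: "x \<in> H" "z \<in> H"
  shows "ip z (fc (\<lambda>u. \<Sum>j\<in>J. w j * f j u) x) = (\<Sum>j\<in>J. of_real (w j) * ip z (fc (f j) x))"
  using assms(1,2)
proof (induction J rule: finite_induct)
  case empty
  have "fc (\<lambda>u. 0) x = pop 0 x" using fc_poly[of x 0] by (simp add: poly_0[abs_def])
  then show ?case by simp
next
  case (insert j J)
  then show ?case by (simp add: ip_fc_add fc_scale continuous_intros)
qed

lemma fc_mono:
  assumes f: "continuous_on {0..1} f" and h: "continuous_on {0..1} h" and x: "x \<in> H"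
    and le: "\<And>u. 0 \<le> u \<Longrightarrow> u \<le> 1 \<Longrightarrow> f u \<le> h u"
  shows "Re (ip x (fc f x)) \<le> Re (ip x (fc h x))"
proof (rule field_le_epsilon)
  fix e :: real assume e: "e > 0"
  define d where "d = e / (2 * (Re (ip x x) + 1))"
  have nx: "Re (ip x x) + 1 > 0" using ip_pos[OF x] by linarith
  have d: "d > 0" using e nx by (simp add: d_def)
  obtain g where g: "uconv g f" using uniform_poly_approx[OF f] by blast
  obtain k where k: "uconv k h" using uniform_poly_approx[OF h] by blast
  have ev: "\<forall>\<^sub>F n in sequentially. Re (ip x (pop (g n) x)) \<le> Re (ip x (pop (k n) x)) + 2 * d * Re (ip x x)"
    using uniform_limitD[OF g d] uniform_limitD[OF k d]
  proof eventually_elim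
    case (elim n)
    show ?case
    proof (rule pop_mono_eps[OF x])
      fix u :: real assume "0 \<le> u" "u \<le> 1"
      then show "poly (g n) u \<le> poly (k n) u + 2 * d" using elim le[of u] by (force simp: dist_real_def)
    qed
  qed
  have "Re (ip x (fc f x)) \<le> Re (ip x (fc h x)) + 2 * d * Re (ip x x)"
    by (rule tendsto_le[OF _ _ _ ev])
      (auto intro!: tendsto_intros fc_ip_lim f g h k x)
  also have "2 * d * Re (ip x x) \<le> 2 * d * (Re (ip x x) + 1)" using d by simp
  also have "2 * d * (Re (ip x x) + 1) = e" using nx by (simp add: d_def field_simps)
  finally show "Re (ip x (fc f x)) \<le> Re (ip x (fc h x)) + e" by simp
qed

text \<open>Brings functions of Q = 1 - T into the calculus of T, so that powers of both operators
  can be multiplied by \<open>fc_mult\<close>. On polynomials it is composition with 1 - X.\<close>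

lemma fc_one_minus:
  assumes f: "continuous_on {0..1} f" and x: "x \<in> H"
    and Q: "hilb_op H pl sc ip zr Q" "\<And>y. y \<in> H \<Longrightarrow> Q y = dif y (T y)"
  shows "hilb_op.fc H pl sc ip zr Q f x = fc (\<lambda>u. f (1 - u)) x"
proof -
  interpret Q: hilb_op H pl sc ip zr Q by (rule Q)
  have pp: "Q.pop g y = pop (pcompose g [:1,-1:]) y" if "y \<in> H" for g y
    using that
  proof (induction g)
    case (pCons c g)
    show ?case
    proof (rule ip_ext)
      fix z assume "z \<in> H"
      then show "ip z (Q.pop (pCons c g) y) = ip z (pop (pCons c g \<circ>\<^sub>p [:1, - 1:]) y)"
        using pCons
        by (simp add: Q.pop_pCons Q pcompose_pCons ip_pop_add ip_pop_pCons T_zr pop_pCons ip_T_pop_uminus)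
    qed (use pCons in auto)
  qed simp
  have f1: "continuous_on {0..1} (\<lambda>u. f (1 - u))"
    by (rule continuous_on_compose2[OF f]) (auto intro!: continuous_intros)
  obtain g where g: "uconv g f" using uniform_poly_approx[OF f] by blast
  have "uniform_limit {0..1} (\<lambda>n u. poly (g n) (1 - u)) (\<lambda>u. f (1 - u)) sequentially"
    unfolding uniform_limit_iff
  proof (intro allI impI)
    fix e :: real assume "e > 0"
    from uniform_limitD[OF g this]
    show "\<forall>\<^sub>F n in sequentially. \<forall>u\<in>{0..1}. dist (poly (g n) (1 - u)) (f (1 - u)) < e"
      by eventually_elim simp
  qed
  then have g1: "uconv (\<lambda>n. pcompose (g n) [:1,-1:]) (\<lambda>u. f (1 - u))" by (simp add: poly_pcompose')
  have "tends (\<lambda>n. Q.pop (g n) x) (Q.fc f x)" using Q.fc_tends f x g by blast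
  then have "tends (\<lambda>n. pop (pcompose (g n) [:1,-1:]) x) (Q.fc f x)" using x by (simp add: pp)
  then show ?thesis using fc_unique[OF g1 f1 x] Q.fc_closed[OF f x] by blast
qed

end

text \<open>The function which the calculus turns into the parallel sum of T and l (1 - T).\<close>
definition psum :: "real \<Rightarrow> real \<Rightarrow> real" where
  "psum l u = l * u * (1 - u) / (u + l * (1 - u))"

lemma psum_denom_pos: "0 < l \<Longrightarrow> 0 \<le> u \<Longrightarrow> u \<le> 1 \<Longrightarrow> 0 < u + l * (1 - u)" for l u :: real
  by (cases "u = 1") (auto intro!: add_nonneg_pos)

lemma continuous_on_psum: "0 < l \<Longrightarrow> continuous_on {0..1} (psum l)"
  unfolding psum_def using psum_denom_pos[of l] by (force intro!: continuous_intros)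

section \<open>The variational form of the parallel sum\<close>

context hilb_op
begin

text \<open>The cost of splitting a into b, measured by T, and a - b, measured by l (1 - T). Its
  minimum over b is the quadratic form of the parallel sum.\<close>

definition split_val :: "real \<Rightarrow> 'a \<Rightarrow> 'a \<Rightarrow> real" where
  "split_val l a b = Re (ip b (T b)) + l * (Re (ip (dif a b) (dif a b)) - Re (ip (dif a b) (T (dif a b))))"

text \<open>The Euler equation of the minimisation is T b = l (1 - T) (a - b). It is solved inside
  the functional calculus by b0 = h(T) a, and both sides then equal G = psum_l(T) a.\<close>

lemma split_val_minimum:
  assumes l: "0 < l" and [simp]: "a \<in> H"
  shows "\<exists>b0\<in>H. split_val l a b0 = Re (ip a (fc (psum l) a)) \<and>
    (\<forall>b\<in>H. split_val l a b0 \<le> split_val l a b)"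
proof -
  \<comment> \<open>The scalar solution of u h = l (1 - u) (1 - h).\<close>
  define h where "h u = l * (1 - u) / (u + l * (1 - u))" for u
  have hc: "continuous_on {0..1} h"
    unfolding h_def using psum_denom_pos[OF l] by (force intro!: continuous_intros)
  have hc': "continuous_on {0..1} (\<lambda>u. 1 + - 1 * h u)" by (intro continuous_intros hc)
  define b0 where "b0 = fc h a"
  define G where "G = fc (psum l) a"
  have [simp]: "b0 \<in> H" "G \<in> H"
    unfolding b0_def G_def using l by (auto intro!: fc_closed hc continuous_on_psum)
  have TG: "T b0 = G"
  proof -
    have "T b0 = fc (poly [:0,1:]) b0" by (simp add: fc_poly pop_X del: poly_pCons)
    also have "\<dots> = fc (\<lambda>u. poly [:0,1:] u * h u) a"
      unfolding b0_def by (intro fc_mult hc continuous_intros) simp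
    also have "\<dots> = G" unfolding G_def by (rule fc_cong) (simp add: h_def psum_def mult_ac)
    finally show ?thesis .
  qed
  have u0: "dif a b0 = fc (\<lambda>u. 1 + - 1 * h u) a"
  proof (rule ip_ext)
    have one: "fc (\<lambda>u. 1) a = a" using fc_poly[of a 1] by (simp add: poly_1[abs_def])
    fix z assume [simp]: "z \<in> H"
    have "ip z (fc (\<lambda>u. 1 + - 1 * h u) a) = ip z (fc (\<lambda>u. 1) a) + ip z (fc (\<lambda>u. - 1 * h u) a)"
      by (rule ip_fc_add) (auto intro!: continuous_intros hc)
    also have "\<dots> = ip z a - ip z b0" unfolding one fc_scale[OF hc \<open>a \<in> H\<close>] using hc by (simp add: b0_def)
    finally show "ip z (dif a b0) = ip z (fc (\<lambda>u. 1 + - 1 * h u) a)" by simp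
  qed (use hc' in auto)
  have QG: "l * (ip z (dif a b0) - ip z (T (dif a b0))) = ip z G" if [simp]: "z \<in> H" for z
  proof -
    have "l * (ip z (dif a b0) - ip z (T (dif a b0))) = ip z (pop [:l,-l:] (dif a b0))"
      by (simp add: pop_pCons T_pl T_sc T_zr algebra_simps)
    also have "pop [:l,-l:] (dif a b0) = fc (poly [:l,-l:]) (dif a b0)" by (simp add: fc_poly del: poly_pCons)
    also have "\<dots> = fc (\<lambda>u. poly [:l,-l:] u * (1 + - 1 * h u)) a"
      unfolding u0 by (intro fc_mult hc' continuous_intros) simp
    also have "\<dots> = G" unfolding G_def
    proof (rule fc_cong)
      fix u :: real assume "0 \<le> u" "u \<le> 1"
      then show "poly [:l,-l:] u * (1 + - 1 * h u) = psum l u"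
        using psum_denom_pos[OF l, of u] by (simp add: h_def psum_def field_simps)
    qed
    finally show ?thesis .
  qed
  have QGr: "l * (Re (ip z (dif a b0)) - Re (ip z (T (dif a b0)))) = Re (ip z G)" if "z \<in> H" for z
    using arg_cong[OF QG[OF that], of Re] by simp
  have val: "split_val l a b0 = Re (ip a G)"
    unfolding split_val_def TG QGr[OF dif_closed[OF \<open>a \<in> H\<close> \<open>b0 \<in> H\<close>]] by simp
  have "split_val l a b0 \<le> split_val l a b" if [simp]: "b \<in> H" for b
  proof -
    \<comment> \<open>Completing the squares: T is positive at b - b0 and 1 - T at c - d, and all
      cross terms are inner products with G. They add up to <a, G> because b + c = a = b0 +
      d.\<close>
    define c d where "c = dif a b" and "d = dif a b0"
    have [simp]: "c \<in> H" "d \<in> H" by (simp_all add: c_def d_def)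
    have "0 \<le> Re (ip (dif b b0) (T (dif b b0)))" by (rule T_pos) simp
    then have 1: "2 * Re (ip b G) - Re (ip b0 G) \<le> Re (ip b (T b))"
      using TG T_sym[of b0 b] Re_ip_commute[of G b] by (simp add: ip_T_dif)
    have "0 \<le> l * (Re (ip (dif c d) (dif c d)) - Re (ip (dif c d) (T (dif c d))))"
      using l T_le[of "dif c d"] by simp
    also have "\<dots> = l * (Re (ip c c) - Re (ip c (T c))) - 2 * (l * (Re (ip c d) - Re (ip c (T d))))
        + l * (Re (ip d d) - Re (ip d (T d)))"
      using T_sym[of d c] Re_ip_commute[of "T d" c] Re_ip_commute[of d c]
      by (simp add: ip_T_dif algebra_simps)
    also have "\<dots> = l * (Re (ip c c) - Re (ip c (T c))) - 2 * Re (ip c G) + Re (ip d G)"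
      using QGr[of c] QGr[of d] by (simp add: d_def)
    finally have 2: "0 \<le> \<dots>" .
    have "Re (ip c G) = Re (ip a G) - Re (ip b G)" "Re (ip d G) = Re (ip a G) - Re (ip b0 G)"
      by (simp_all add: c_def d_def)
    moreover have "split_val l a b = Re (ip b (T b)) + l * (Re (ip c c) - Re (ip c (T c)))"
      by (simp only: split_val_def c_def)
    ultimately show ?thesis using val 1 2 by linarith
  qed
  then show ?thesis using val by (auto simp: G_def intro!: bexI[of _ b0])
qed

end

subsection \<open>The geometric mean as a combination of parallel sums\<close>

lemma psum_nonneg: "0 < l \<Longrightarrow> 0 \<le> u \<Longrightarrow> u \<le> 1 \<Longrightarrow> 0 \<le> psum l u"
  using psum_denom_pos[of l u] by (simp add: psum_def)

text \<open>A parallel sum lies below both of its summands, here u and l (1 - u). The two bounds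
  control the series over l = q^j for positive and for negative j.\<close>

lemma psum_le_min:
  assumes "0 < l" "0 \<le> u" "u \<le> 1"
  shows "psum l u \<le> 1" "psum l u \<le> l"
proof -
  have d: "0 < u + l * (1 - u)" using assms by (rule psum_denom_pos)
  have "0 \<le> u * u" "0 \<le> l * (1 - u) * (l * (1 - u))" by simp_all
  then have "l * u * (1 - u) \<le> u * (u + l * (1 - u))" "l * u * (1 - u) \<le> (l * (1 - u)) * (u + l * (1 - u))"
    by (simp_all add: algebra_simps)
  then have "psum l u \<le> u" "psum l u \<le> l * (1 - u)"
    unfolding psum_def using d by (simp_all add: pos_divide_le_eq)
  moreover have "l * (1 - u) \<le> l" using assms by (simp add: mult_left_le)
  ultimately show "psum l u \<le> 1" "psum l u \<le> l" using assms by linarith+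
qed

lemma summable_on_int_geometric:
  assumes "0 \<le> \<rho>" "\<rho> < (1::real)"
  shows "(\<lambda>j::int. \<rho> ^ nat \<bar>j\<bar>) summable_on UNIV"
proof -
  have g: "(\<lambda>n. \<rho> ^ n) summable_on (UNIV :: nat set)"
    using assms by (subst summable_on_UNIV_nonneg_real_iff) (auto intro!: summable_geometric)
  have "(\<lambda>j::int. \<rho> ^ nat \<bar>j\<bar>) summable_on range int"
    by (subst summable_on_reindex) (use g in \<open>auto simp: o_def\<close>)
  moreover have "(\<lambda>j::int. \<rho> ^ nat \<bar>j\<bar>) summable_on range (\<lambda>n. - int n)"
    by (subst summable_on_reindex) (use g in \<open>auto simp: o_def inj_def\<close>)
  ultimately have "(\<lambda>j::int. \<rho> ^ nat \<bar>j\<bar>) summable_on (range int \<union> range (\<lambda>n. - int n))"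
    by (rule summable_on_union)
  also have "range int \<union> range (\<lambda>n. - int n) = UNIV"
    by (auto simp: image_iff) (metis int_cases2)
  finally show ?thesis .
qed

text \<open>The scalar function behind P^(1-t) Q^t when Q = 1 - P.\<close>

definition geo :: "real \<Rightarrow> real \<Rightarrow> real" where
  "geo t u = u powr (1 - t) * (1 - u) powr t"

text \<open>With r = u / (1 - u), the quotient of the sum of the q^(-tj) psum (q^j) u over all integers j by
  geo t u is a function of r that is invariant under r -> q r and varies by at most a factor q over one
  period. So up to a factor close to 1 the geometric mean is a positive combination of parallel sums;
  this replaces the usual integral representation.\<close>
lemma geo_psum_approx:
  fixes t q e :: real
  assumes t: "0 < t" "t < 1" and q: "1 < q" and e: "0 < e"
  shows "\<exists>(J :: int set) w l. finite J \<and> (\<forall>j. 0 \<le> w j \<and> 0 < l j) \<and>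
    (\<forall>u\<in>{0..1}. geo t u \<le> (\<Sum>j\<in>J. w j * psum (l j) u) + e \<and>
                 (\<Sum>j\<in>J. w j * psum (l j) u) \<le> q\<^sup>2 * geo t u)"
proof -
  define qp where "qp x = q powr x" for x :: real
  have qp_pos [simp]: "qp x > 0" for x using q by (simp add: qp_def)
  have qp_add: "qp (x + y) = qp x * qp y" for x y by (simp add: qp_def powr_add)
  define b where "b j u = qp (- t * of_int j) * psum (qp (of_int j)) u" for j :: int and u
  \<comment> \<open>This is \<open>b j u / geo t u\<close> in the variable r = u / (1 - u).
    Replacing r by q r and j by j + 1 together leaves it unchanged.\<close>
  define a where "a j r = r powr t * qp ((1 - t) * of_int j) / (r + qp (of_int j))" for j :: int and r
  \<comment> \<open>The terms decay like q^(-t j) as j grows and like q^(-(1 - t) |j|) in the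
    negative direction; both rates are below 1 as 0 < t < 1.\<close>
  define \<rho> where "\<rho> = max (qp (- t)) (qp (t - 1))"
  have \<rho>: "0 \<le> \<rho>" "\<rho> < 1"
    using t q by (auto simp: \<rho>_def qp_def le_max_iff_disj intro!: powr_less_one)
  define M where "M j = \<rho> ^ nat \<bar>j\<bar>" for j :: int
  have M: "M summable_on UNIV" unfolding M_def using \<rho> by (rule summable_on_int_geometric)
  have b0: "0 \<le> b j u" if "0 \<le> u" "u \<le> 1" for j u
    using that by (simp add: b_def psum_nonneg less_imp_le)
  have bM: "b j u \<le> M j" if u: "0 \<le> u" "u \<le> 1" for j u
  proof (cases "0 \<le> j")
    case True
    have "b j u \<le> qp (- t * of_int j) * 1"
      unfolding b_def by (intro mult_left_mono psum_le_min u) (auto simp: less_imp_le)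
    also have "\<dots> = qp (- t) ^ nat \<bar>j\<bar>" using True q by (simp add: qp_def powr_power mult.commute)
    also have "\<dots> \<le> M j" unfolding M_def by (intro power_mono) (auto simp: \<rho>_def less_imp_le)
    finally show ?thesis .
  next
    case False
    have "b j u \<le> qp (- t * of_int j) * qp (of_int j)"
      unfolding b_def by (intro mult_left_mono psum_le_min u) (auto simp: less_imp_le)
    also have "\<dots> = qp ((t - 1) * of_int \<bar>j\<bar>)" using False by (simp add: algebra_simps flip: qp_add)
    also have "\<dots> = qp (t - 1) ^ nat \<bar>j\<bar>" using False q by (simp add: qp_def powr_power mult.commute)
    also have "\<dots> \<le> M j" unfolding M_def by (intro power_mono) (auto simp: \<rho>_def less_imp_le)
    finally show ?thesis .
  qed
  have bs: "(\<lambda>j. b j u) summable_on UNIV" if "0 \<le> u" "u \<le> 1" for u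
    by (rule summable_on_comparison_test[OF M]) (use b0[OF that] bM[OF that] in auto)
  define \<phi> where "\<phi> u = infsum (\<lambda>j. b j u) UNIV" for u
  define A where "A r = infsum (\<lambda>j. a j r) UNIV" for r
  have ab: "b j u = geo t u * a j (u / (1 - u))" if u: "0 < u" "u < 1" for j u
  proof -
    define L where "L = qp (of_int j)"
    have L: "L > 0" by (simp add: L_def)
    have d: "u + L * (1 - u) > 0" using psum_denom_pos[of L u] u L by simp
    have g: "geo t u * (u / (1 - u)) powr t = u"
    proof -
      have "geo t u * (u / (1 - u)) powr t = u powr (1 - t) * u powr t * ((1 - u) powr t / (1 - u) powr t)"
        using u by (simp add: geo_def powr_divide)
      also have "\<dots> = u" using u by (simp flip: powr_add)
      finally show ?thesis .
    qed
    have "qp ((1 - t) * of_int j) = qp (- t * of_int j) * L"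
      unfolding L_def qp_add[symmetric] by (simp add: algebra_simps)
    then have "geo t u * a j (u / (1 - u)) = u * (qp (- t * of_int j) * L) / (u / (1 - u) + L)"
      unfolding a_def L_def[symmetric] using g by simp
    also have "\<dots> = qp (- t * of_int j) * psum L u"
    proof -
      have "u / (1 - u) + L = (u + L * (1 - u)) / (1 - u)" using u by (simp add: field_simps)
      then show ?thesis using u by (simp add: psum_def)
    qed
    finally show ?thesis by (simp add: b_def L_def)
  qed
  have geo_pos: "geo t u > 0" if "0 < u" "u < 1" for u using that by (simp add: geo_def)
  have as: "(\<lambda>j. a j r) summable_on UNIV" if r: "0 < r" for r
  proof -
    define u where "u = r / (1 + r)"
    have u: "0 < u" "u < 1" "u / (1 - u) = r" using r by (auto simp: u_def field_simps)
    have "(\<lambda>j. b j u / geo t u) summable_on UNIV"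
      using summable_on_cmult_left[OF bs[of u], of "1 / geo t u"] u by simp
    also have "(\<lambda>j. b j u / geo t u) = (\<lambda>j. a j r)"
      using ab[OF u(1,2)] u(3) geo_pos[OF u(1,2)] by auto
    finally show ?thesis .
  qed
  have \<phi>A: "\<phi> u = geo t u * A (u / (1 - u))" if "0 < u" "u < 1" for u
    unfolding \<phi>_def A_def using ab[OF that] by (simp add: infsum_cmult_right')
  have shift: "A (qp (of_int k)) = A 1" for k :: int
  proof -
    have "a (j + k) (qp (of_int k)) = a j 1" for j
    proof -
      have "qp (of_int k) powr t * qp ((1 - t) * of_int (j + k)) = qp ((1 - t) * of_int j) * qp (of_int k)"
        using q by (simp add: qp_def powr_powr algebra_simps flip: powr_add)
      moreover have "qp (of_int k) + qp (of_int (j + k)) = (1 + qp (of_int j)) * qp (of_int k)"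
        by (simp add: qp_add algebra_simps)
      ultimately show ?thesis by (simp add: a_def less_imp_neq[symmetric])
    qed
    then have "A 1 = infsum (\<lambda>j. a (j + k) (qp (of_int k))) UNIV" by (simp add: A_def)
    also have "\<dots> = A (qp (of_int k))" unfolding A_def
      by (rule infsum_reindex_bij_betw) (auto intro!: bij_betw_byWitness[of _ "\<lambda>j. j - k"])
    finally show ?thesis by simp
  qed
  have A_bound: "A r \<le> q * A 1" "A 1 \<le> q * A r" if r: "0 < r" for r
  proof -
    \<comment> \<open>r lies in the period from r0 = q^k to q r0, and \<open>shift\<close> reduces
      r0 to 1. Within a period the numerator of \<open>a\<close> grows by at most q^t <= q and the
      denominator by at most q.\<close>
    define k where "k = \<lfloor>log q r\<rfloor>"
    define r0 where "r0 = qp (of_int k)"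
    have r0: "r0 > 0" by (simp add: r0_def)
    have "of_int k \<le> log q r" "log q r \<le> of_int k + 1" unfolding k_def by linarith+
    then have le: "r0 \<le> r" "r \<le> q * r0"
      using q r unfolding r0_def qp_def
      by (simp_all add: le_log_iff log_le_iff powr_add mult.commute)
    have 1: "a j r \<le> q * a j r0" for j
    proof -
      have "r powr t \<le> (q * r0) powr t" using le r t by (intro powr_mono2) auto
      also have "\<dots> = q powr t * r0 powr t" using q r0 by (simp add: powr_mult)
      also have "\<dots> \<le> q * r0 powr t" using q t powr_mono[of t 1 q] by (intro mult_right_mono) auto
      finally have "a j r \<le> (q * r0 powr t) * qp ((1 - t) * of_int j) / (r0 + qp (of_int j))"
        unfolding a_def using le r r0 q by (intro frac_le mult_right_mono) (auto simp: less_imp_le add_pos_pos)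
      then show ?thesis by (simp add: a_def mult_ac)
    qed
    have 2: "a j r0 \<le> q * a j r" for j
    proof -
      have p: "r0 powr t \<le> r powr t" using le r0 t by (intro powr_mono2) auto
      have d: "r + qp (of_int j) \<le> q * (r0 + qp (of_int j))"
        using le(2) q by (simp add: distrib_left add_mono)
      have "a j r0 = q * (r0 powr t * qp ((1 - t) * of_int j)) / (q * (r0 + qp (of_int j)))"
        using q by (simp add: a_def)
      also have "\<dots> \<le> q * (r powr t * qp ((1 - t) * of_int j)) / (r + qp (of_int j))"
        using p d q r by (intro frac_le mult_left_mono mult_right_mono) (auto simp: less_imp_le add_pos_pos)
      finally show ?thesis by (simp add: a_def mult_ac)
    qed
    have "A r \<le> infsum (\<lambda>j. q * a j r0) UNIV" unfolding A_def
      by (intro infsum_mono as r summable_on_cmult_right r0 1)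
    also have "\<dots> = q * A r0" by (simp add: A_def infsum_cmult_right')
    finally show "A r \<le> q * A 1" using shift[of k] by (simp add: r0_def)
    have "A r0 \<le> infsum (\<lambda>j. q * a j r) UNIV" unfolding A_def
      by (intro infsum_mono as r summable_on_cmult_right r0 2)
    also have "\<dots> = q * A r" by (simp add: A_def infsum_cmult_right')
    finally show "A 1 \<le> q * A r" using shift[of k] by (simp add: r0_def)
  qed
  have A1: "A 1 > 0"
  proof -
    have "(\<Sum>j\<in>{0}. a j 1) \<le> A 1" unfolding A_def
      by (intro finite_sum_le_infsum as) (auto simp: a_def less_imp_le)
    moreover have "a 0 1 > 0" using q by (simp add: a_def qp_def)
    ultimately show ?thesis by simp
  qed
  \<comment> \<open>The tail is later multiplied by q / A 1, which turns d into e. One set J serves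
    all u because the majorant M does not depend on u.\<close>
  define d where "d = e * A 1 / q"
  have d: "d > 0" using e A1 q by (simp add: d_def)
  obtain J where J: "finite J" "infsum M UNIV \<le> sum M J + d"
    using infsum_finite_approximation[OF M d] unfolding dist_real_def by (auto simp: abs_le_iff)
  have tail: "\<phi> u \<le> (\<Sum>j\<in>J. b j u) + d" if u: "0 \<le> u" "u \<le> 1" for u
  proof -
    have sb: "(\<lambda>j. b j u) summable_on (UNIV - J)" and sM: "M summable_on (UNIV - J)"
      using bs[OF u] M J(1) by (auto intro: summable_on_subset)
    have "\<phi> u = infsum (\<lambda>j. b j u) J + infsum (\<lambda>j. b j u) (UNIV - J)"
      unfolding \<phi>_def using infsum_Un_disjoint[of "\<lambda>j. b j u" J "UNIV - J"] sb J(1) by auto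
    also have "infsum (\<lambda>j. b j u) (UNIV - J) \<le> infsum M (UNIV - J)"
      by (intro infsum_mono sb sM bM u)
    also have "infsum M (UNIV - J) = infsum M UNIV - sum M J"
      using infsum_Un_disjoint[of M J "UNIV - J"] sM J(1) by auto
    finally show ?thesis using J by simp
  qed
  \<comment> \<open>One factor q lifts A r above A 1, as the lower bound requires; the estimate A r
    <= q A 1 then costs a second one, hence q^2 in the upper bound.\<close>
  define w where "w j = q / A 1 * qp (- t * of_int j)" for j :: int
  define l where "l j = qp (of_int j)" for j :: int
  have sumeq: "(\<Sum>j\<in>J. w j * psum (l j) u) = q / A 1 * (\<Sum>j\<in>J. b j u)" for u
    by (simp add: w_def l_def b_def sum_distrib_left mult_ac)
  have "geo t u \<le> (\<Sum>j\<in>J. w j * psum (l j) u) + e \<and> (\<Sum>j\<in>J. w j * psum (l j) u) \<le> q\<^sup>2 * geo t u"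
    if u: "u \<in> {0..1}" for u
  \<comment> \<open>At the endpoints the variable r is unusable, but \<open>geo\<close> and every
    \<open>psum\<close> vanish there.\<close>
  proof (cases "u = 0 \<or> u = 1")
    case True
    then have "geo t u = 0" "\<And>j. psum (l j) u = 0" by (auto simp: geo_def psum_def)
    then show ?thesis using e by simp
  next
    case False
    then have u': "0 < u" "u < 1" using u by auto
    define r where "r = u / (1 - u)"
    have r: "r > 0" using u' by (simp add: r_def)
    have g: "geo t u > 0" using geo_pos u' by simp
    have "q / A 1 * d = e" using A1 q by (simp add: d_def)
    moreover have "geo t u \<le> q / A 1 * \<phi> u"
    proof -
      have "geo t u * A 1 \<le> geo t u * (q * A r)" using A_bound(2)[OF r] g by (intro mult_left_mono) auto
      then show ?thesis using A1 \<phi>A[OF u'] by (simp add: r_def field_simps)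
    qed
    moreover have "q / A 1 * \<phi> u \<le> q / A 1 * ((\<Sum>j\<in>J. b j u) + d)"
      using tail[of u] u A1 q by (intro mult_left_mono) auto
    ultimately have 1: "geo t u \<le> (\<Sum>j\<in>J. w j * psum (l j) u) + e"
      unfolding sumeq distrib_left by linarith
    have "(\<Sum>j\<in>J. b j u) \<le> \<phi> u" unfolding \<phi>_def
      using u J(1) by (intro finite_sum_le_infsum bs) (auto intro: b0)
    also have "\<phi> u \<le> geo t u * (q * A 1)"
      unfolding \<phi>A[OF u'] using A_bound(1)[OF r] g by (intro mult_left_mono) (auto simp: r_def)
    finally have "q / A 1 * (\<Sum>j\<in>J. b j u) \<le> q / A 1 * (geo t u * (q * A 1))"
      using A1 q by (intro mult_left_mono) auto
    also have "\<dots> = q\<^sup>2 * geo t u" using A1 by (simp add: power2_eq_square)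
    finally show ?thesis using 1 sumeq by simp
  qed
  moreover have "\<forall>j. 0 \<le> w j \<and> 0 < l j" using A1 q by (simp add: w_def l_def less_imp_le)
  ultimately show ?thesis using J(1) by blast
qed

lemma continuous_on_geo: "0 < t \<Longrightarrow> t < 1 \<Longrightarrow> continuous_on {0..1} (geo t)"
  unfolding geo_def by (intro continuous_intros continuous_on_powr') auto

subsection \<open>The completion attached to a pair of forms\<close>

text \<open>Group subtraction, used for Cauchy sequences, and \<open>sc (-1)\<close>, used in
  \<open>dif\<close>, are not related by any axiom. They agree under a form, which is additive on (x
  - y) + y.\<close>

lemma form_diff_right: "semi_ip UNIV (+) sc r \<Longrightarrow> r z (x - y) = r z x - r z y"
  for r :: "'v::ab_group_add \<Rightarrow> 'v \<Rightarrow> complex"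
  using semi_ip.ip_pl[of UNIV "(+)" sc r "x - y" y z] by simp

lemma form_diff_left: "semi_ip UNIV (+) sc r \<Longrightarrow> r (x - y) z = r x z - r y z"
  for r :: "'v::ab_group_add \<Rightarrow> 'v \<Rightarrow> complex"
  using semi_ip.ip_pl_left[of UNIV "(+)" sc r "x - y" y z] by simp

lemma semi_ip_add:
  assumes "semi_ip H pl sc p" "semi_ip H pl sc q"
  shows "semi_ip H pl sc (\<lambda>a b. p a b + q a b)"
proof -
  interpret p: semi_ip H pl sc p by (rule assms)
  interpret q: semi_ip H pl sc q by (rule assms)
  show ?thesis
    by unfold_locales (auto simp: algebra_simps p.ip_pos q.ip_pos intro: arg_cong2[where f="(+)"] p.ip_cnj q.ip_cnj)
qed

locale form_pair =
  fixes sc :: "complex \<Rightarrow> 'v \<Rightarrow> 'v::ab_group_add"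
    and p q :: "'v \<Rightarrow> 'v \<Rightarrow> complex"
  assumes p_form: "semi_ip UNIV (+) sc p"
    and q_form: "semi_ip UNIV (+) sc q"
begin

abbreviation "sf \<equiv> sform p q"

lemma s_form: "semi_ip UNIV (+) sc sf"
  using semi_ip_add[OF p_form q_form] by (simp add: sform_def[abs_def])

sublocale s: semi_ip UNIV "(+)" sc sf by (rule s_form)

section \<open>The seminorm, Cauchy sequences and their classes\<close>

definition N :: "'v \<Rightarrow> real" where "N x = sqrt (Re (sf x x))"

lemma N_eq: "N x = s.nrm x"
  by (simp add: N_def s.nrm_def)

lemma N_dif: "N (x - y) = s.nrm (s.dif x y)"
  unfolding N_def s.nrm_def by (simp add: form_diff_left[OF s_form] form_diff_right[OF s_form])

lemma N_nonneg [simp]: "0 \<le> N x"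
  by (simp add: N_eq)

lemma N_triangle: "N (x - z) \<le> N (x - y) + N (y - z)"
  unfolding N_dif by (rule s.nrm_dif_triangle) auto

lemma N_commute: "N (x - y) = N (y - x)"
  unfolding N_dif by (rule s.nrm_dif_commute) auto

lemma N_le: "N x \<le> N (x - y) + N y"
  unfolding N_dif unfolding N_eq by (rule s.nrm_le_dif) auto

text \<open>The definitions use the squared seminorm, whereas triangle inequality arguments need the
  seminorm itself.\<close>

lemma s_cauchy_iff: "s_cauchy p q X \<longleftrightarrow> (\<forall>e>0. \<exists>M. \<forall>m\<ge>M. \<forall>n\<ge>M. N (X m - X n) < e)"
proof
  assume X: "s_cauchy p q X"
  show "\<forall>e>0. \<exists>M. \<forall>m\<ge>M. \<forall>n\<ge>M. N (X m - X n) < e"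
  proof (intro allI impI)
    fix e :: real assume "e > 0"
    then have "e\<^sup>2 > 0" by simp
    then obtain M where "\<forall>m\<ge>M. \<forall>n\<ge>M. Re (sf (X m - X n) (X m - X n)) < e\<^sup>2"
      using X unfolding s_cauchy_def by blast
    then have "\<forall>m\<ge>M. \<forall>n\<ge>M. N (X m - X n) < e"
      unfolding N_def using \<open>e > 0\<close> by (auto intro!: real_less_lsqrt s.ip_pos)
    then show "\<exists>M. \<forall>m\<ge>M. \<forall>n\<ge>M. N (X m - X n) < e" by blast
  qed
next
  assume X: "\<forall>e>0. \<exists>M. \<forall>m\<ge>M. \<forall>n\<ge>M. N (X m - X n) < e"
  show "s_cauchy p q X" unfolding s_cauchy_def
  proof (intro allI impI)
    fix e :: real assume "e > 0"
    then have "sqrt e > 0" by simp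
    then obtain M where "\<forall>m\<ge>M. \<forall>n\<ge>M. N (X m - X n) < sqrt e" using X by blast
    then show "\<exists>M. \<forall>m\<ge>M. \<forall>n\<ge>M. Re (sf (X m - X n) (X m - X n)) < e"
      unfolding N_def real_sqrt_less_iff by blast
  qed
qed

lemma s_equiv_iff: "s_equiv p q X Y \<longleftrightarrow> (\<lambda>n. N (X n - Y n)) \<longlonglongrightarrow> 0"
proof
  assume "s_equiv p q X Y"
  then have "(\<lambda>n. sqrt (Re (sf (X n - Y n) (X n - Y n)))) \<longlonglongrightarrow> sqrt 0"
    unfolding s_equiv_def by (rule tendsto_real_sqrt)
  then show "(\<lambda>n. N (X n - Y n)) \<longlonglongrightarrow> 0" by (simp add: N_def)
next
  assume "(\<lambda>n. N (X n - Y n)) \<longlonglongrightarrow> 0"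
  then have "(\<lambda>n. (N (X n - Y n))\<^sup>2) \<longlonglongrightarrow> 0\<^sup>2" by (rule tendsto_power)
  then show "s_equiv p q X Y" by (simp add: s_equiv_def N_def s.ip_pos)
qed

lemma s_equiv_refl: "s_equiv p q X X"
  using form_diff_left[OF s_form, of "0::'v" "0::'v"] by (simp add: s_equiv_def)

lemma s_equiv_sym: "s_equiv p q X Y \<Longrightarrow> s_equiv p q Y X"
  by (simp add: s_equiv_iff N_commute[of "X _"])

lemma s_equiv_trans:
  assumes "s_equiv p q X Y" "s_equiv p q Y Z"
  shows "s_equiv p q X Z"
proof -
  have "(\<lambda>n. N (X n - Y n) + N (Y n - Z n)) \<longlonglongrightarrow> 0"
    using tendsto_add[OF assms[unfolded s_equiv_iff]] by simp
  then show ?thesis unfolding s_equiv_iff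
    by (rule Lim_null_comparison[rotated]) (auto intro!: always_eventually N_triangle)
qed

lemma hcls_eq_iff:
  assumes "s_cauchy p q X" "s_cauchy p q Y"
  shows "hcls p q X = hcls p q Y \<longleftrightarrow> s_equiv p q X Y"
proof
  assume "hcls p q X = hcls p q Y"
  moreover have "Y \<in> hcls p q Y" using assms s_equiv_refl by (simp add: hcls_def)
  ultimately show "s_equiv p q X Y" by (auto simp: hcls_def)
next
  assume "s_equiv p q X Y"
  then show "hcls p q X = hcls p q Y"
    unfolding hcls_def using s_equiv_trans s_equiv_sym by blast
qed

text \<open>\<open>hrep\<close> picks a sequence known only up to \<open>s_equiv\<close>. Since the
  operations on classes are defined through it, each must be shown to act on arbitrary
  representatives.\<close>

lemma hrep_hcls:
  assumes "s_cauchy p q X"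
  shows "s_cauchy p q (hrep (hcls p q X))" "s_equiv p q X (hrep (hcls p q X))"
proof -
  have "X \<in> hcls p q X" using assms s_equiv_refl by (simp add: hcls_def)
  then have "hrep (hcls p q X) \<in> hcls p q X" unfolding hrep_def by (rule someI[of "\<lambda>Y. Y \<in> hcls p q X"])
  then show "s_cauchy p q (hrep (hcls p q X))" "s_equiv p q X (hrep (hcls p q X))"
    by (auto simp: hcls_def)
qed

lemma hcls_in [simp]: "s_cauchy p q X \<Longrightarrow> hcls p q X \<in> hspace p q"
  by (auto simp: hspace_def)

lemma hspace_cases:
  assumes "h \<in> hspace p q"
  obtains X where "h = hcls p q X" "s_cauchy p q X"
  using assms by (auto simp: hspace_def)

lemma s_cauchy_const: "s_cauchy p q (\<lambda>_. a)"
  using form_diff_left[OF s_form, of "0::'v" "0::'v"] by (simp add: s_cauchy_def)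

lemma hemb_in [simp]: "hemb p q a \<in> hspace p q"
  by (simp add: hemb_def s_cauchy_const)

lemma s_cauchy_add:
  assumes "s_cauchy p q X" "s_cauchy p q Y"
  shows "s_cauchy p q (\<lambda>n. X n + Y n)"
  unfolding s_cauchy_iff
proof (intro allI impI)
  fix e :: real assume "e > 0"
  then have e: "e / 2 > 0" by simp
  obtain M1 where M1: "\<And>m n. m \<ge> M1 \<Longrightarrow> n \<ge> M1 \<Longrightarrow> N (X m - X n) < e/2"
    using assms(1) e unfolding s_cauchy_iff by blast
  obtain M2 where M2: "\<And>m n. m \<ge> M2 \<Longrightarrow> n \<ge> M2 \<Longrightarrow> N (Y m - Y n) < e/2"
    using assms(2) e unfolding s_cauchy_iff by blast
  have "N (X m + Y m - (X n + Y n)) < e" if "m \<ge> max M1 M2" "n \<ge> max M1 M2" for m n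
  proof -
    have "N (X m + Y m - (X n + Y n)) \<le> N (X m - X n) + N (Y m - Y n)"
      using s.nrm_pl[of "X m - X n" "Y m - Y n"] by (simp add: N_eq algebra_simps)
    then show ?thesis using M1[of m n] M2[of m n] that by simp
  qed
  then show "\<exists>M. \<forall>m\<ge>M. \<forall>n\<ge>M. N (X m + Y m - (X n + Y n)) < e" by blast
qed

lemma N_sc: "N (sc c x) = cmod c * N x"
  unfolding N_eq by (rule s.nrm_sc) simp

lemma N_sc_diff: "N (sc c x - sc c y) = cmod c * N (x - y)"
proof -
  have "N (sc c x - sc c y) = s.nrm (sc c (x - y))"
    unfolding N_eq by (rule s.nrm_cong) (auto simp: form_diff_right[OF s_form] algebra_simps)
  then show ?thesis by (simp add: N_sc[unfolded N_eq] N_eq)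
qed

lemma s_cauchy_sc:
  assumes "s_cauchy p q X"
  shows "s_cauchy p q (\<lambda>n. sc c (X n))"
  unfolding s_cauchy_iff
proof (intro allI impI)
  fix e :: real assume e: "e > 0"
  have c: "cmod c + 1 > 0" by (simp add: add_nonneg_pos)
  then have "e / (cmod c + 1) > 0" using e by simp
  then obtain M where M: "\<And>m n. m \<ge> M \<Longrightarrow> n \<ge> M \<Longrightarrow> N (X m - X n) < e / (cmod c + 1)"
    using assms unfolding s_cauchy_iff by blast
  have "N (sc c (X m) - sc c (X n)) < e" if "m \<ge> M" "n \<ge> M" for m n
  proof -
    have "N (sc c (X m) - sc c (X n)) \<le> (cmod c + 1) * N (X m - X n)"
      unfolding N_sc_diff by (intro mult_right_mono) auto
    also have "\<dots> < e" using M[OF that] c by (simp add: field_simps)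
    finally show ?thesis .
  qed
  then show "\<exists>M. \<forall>m\<ge>M. \<forall>n\<ge>M. N (sc c (X m) - sc c (X n)) < e" by blast
qed

lemma hplus_hcls:
  assumes X: "s_cauchy p q X" and Y: "s_cauchy p q Y"
  shows "hplus p q (hcls p q X) (hcls p q Y) = hcls p q (\<lambda>n. X n + Y n)"
proof -
  let ?X = "hrep (hcls p q X)" and ?Y = "hrep (hcls p q Y)"
  have "(\<lambda>n. N (X n - ?X n) + N (Y n - ?Y n)) \<longlonglongrightarrow> 0"
    using tendsto_add[OF hrep_hcls(2)[OF X, unfolded s_equiv_iff] hrep_hcls(2)[OF Y, unfolded s_equiv_iff]] by simp
  then have "(\<lambda>n. N (X n + Y n - (?X n + ?Y n))) \<longlonglongrightarrow> 0"
  proof (rule Lim_null_comparison[rotated], intro always_eventually allI)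
    fix n
    show "norm (N (X n + Y n - (?X n + ?Y n))) \<le> N (X n - ?X n) + N (Y n - ?Y n)"
      using s.nrm_pl[of "X n - ?X n" "Y n - ?Y n"] by (simp add: N_eq algebra_simps)
  qed
  then have "s_equiv p q (\<lambda>n. X n + Y n) (\<lambda>n. ?X n + ?Y n)" by (simp add: s_equiv_iff)
  then show ?thesis
    unfolding hplus_def using X Y by (subst hcls_eq_iff) (auto intro!: s_cauchy_add hrep_hcls s_equiv_sym)
qed

lemma hscale_hcls:
  assumes X: "s_cauchy p q X"
  shows "hscale sc p q c (hcls p q X) = hcls p q (\<lambda>n. sc c (X n))"
proof -
  let ?X = "hrep (hcls p q X)"
  have "(\<lambda>n. cmod c * N (X n - ?X n)) \<longlonglongrightarrow> 0"
    using tendsto_mult_left[OF hrep_hcls(2)[OF X, unfolded s_equiv_iff], of "cmod c"] by simp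
  then have "s_equiv p q (\<lambda>n. sc c (X n)) (\<lambda>n. sc c (?X n))" by (simp add: s_equiv_iff N_sc_diff)
  then show ?thesis
    unfolding hscale_def using X by (subst hcls_eq_iff) (auto intro!: s_cauchy_sc hrep_hcls s_equiv_sym)
qed

section \<open>Extending bounded forms to the completion\<close>

lemma s_cauchy_bounded:
  assumes "s_cauchy p q X"
  obtains B M where "B > 0" "\<And>n. n \<ge> M \<Longrightarrow> N (X n) \<le> B"
proof -
  obtain M where M: "\<And>m n. m \<ge> M \<Longrightarrow> n \<ge> M \<Longrightarrow> N (X m - X n) < 1"
    using assms unfolding s_cauchy_iff by (meson zero_less_one)
  have "N (X n) \<le> N (X M) + 1" if "n \<ge> M" for n
    using N_le[of "X n" "X M"] M[of n M] that by simp
  moreover have "N (X M) + 1 > 0" using N_nonneg[of "X M"] by linarith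
  ultimately show ?thesis using that by blast
qed

text \<open>Satisfied by p, by q and by their sum, so the extension to the completion is carried out
  once for all three.\<close>

definition dominated :: "('v \<Rightarrow> 'v \<Rightarrow> complex) \<Rightarrow> bool" where
  "dominated r \<longleftrightarrow> semi_ip UNIV (+) sc r \<and> (\<forall>x. Re (r x x) \<le> Re (sf x x))"

lemma dominated_p: "dominated p" and dominated_q: "dominated q" and dominated_s: "dominated sf"
  using p_form q_form s_form semi_ip.ip_pos[OF p_form] semi_ip.ip_pos[OF q_form]
  by (auto simp: dominated_def sform_def)

lemma dominated_diff_bound:
  assumes "dominated r"
  shows "cmod (r x' y' - r x y) \<le> N (x' - x) * (N (y' - y) + N y) + N x * N (y' - y)"
proof -
  interpret r: semi_ip UNIV "(+)" sc r using assms by (simp add: dominated_def)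
  have r: "semi_ip UNIV (+) sc r" using assms by (simp add: dominated_def)
  have le: "r.nrm x \<le> N x" for x using assms by (simp add: dominated_def r.nrm_def N_def)
  have led: "r.nrm (r.dif x y) \<le> N (x - y)" for x y
  proof -
    have "r.nrm (r.dif x y) = r.nrm (x - y)"
      by (rule r.nrm_cong) (auto simp: form_diff_right[OF r])
    then show ?thesis using le by simp
  qed
  have "cmod (r x' y' - r x y) \<le>
     r.nrm (r.dif x' x) * (r.nrm (r.dif y' y) + r.nrm y) + r.nrm x * r.nrm (r.dif y' y)"
    by (rule r.ip_diff_bound) auto
  also have "\<dots> \<le> N (x' - x) * (N (y' - y) + N y) + N x * N (y' - y)"
    by (intro add_mono mult_mono le led) auto
  finally show ?thesis .
qed

text \<open>For r = \<open>sf\<close> this is \<open>hinner\<close> itself.\<close>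

definition rH :: "('v \<Rightarrow> 'v \<Rightarrow> complex) \<Rightarrow> (nat \<Rightarrow> 'v) set \<Rightarrow> (nat \<Rightarrow> 'v) set \<Rightarrow> complex" where
  "rH r h k = lim (\<lambda>n. r (hrep h n) (hrep k n))"

lemma dominated_convergent:
  assumes r: "dominated r" and X: "s_cauchy p q X" and Y: "s_cauchy p q Y"
  shows "convergent (\<lambda>n. r (X n) (Y n))"
proof (rule Cauchy_convergent, rule CauchyI)
  fix e :: real assume e: "e > 0"
  obtain B1 M1 where B1: "B1 > 0" "\<And>n. n \<ge> M1 \<Longrightarrow> N (X n) \<le> B1" using s_cauchy_bounded[OF X] by blast
  obtain B2 M2 where B2: "B2 > 0" "\<And>n. n \<ge> M2 \<Longrightarrow> N (Y n) \<le> B2" using s_cauchy_bounded[OF Y] by blast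
  \<comment> \<open>d <= 1 keeps N (Y m - Y n) + N (Y n) below 1 + B2; the quotient makes the total
    error d (1 + B2) + B1 d at most e.\<close>
  define d where "d = min 1 (e / (1 + B2 + B1))"
  have S: "1 + B2 + B1 > 0" using B1(1) B2(1) by simp
  then have d: "d > 0" "d \<le> 1" using e by (auto simp: d_def)
  have "d \<le> e / (1 + B2 + B1)" by (simp add: d_def)
  then have de: "d * (1 + B2 + B1) \<le> e" using S by (simp add: pos_le_divide_eq)
  obtain M3 where M3: "\<And>m n. m \<ge> M3 \<Longrightarrow> n \<ge> M3 \<Longrightarrow> N (X m - X n) < d"
    using X d unfolding s_cauchy_iff by blast
  obtain M4 where M4: "\<And>m n. m \<ge> M4 \<Longrightarrow> n \<ge> M4 \<Longrightarrow> N (Y m - Y n) < d"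
    using Y d unfolding s_cauchy_iff by blast
  have "norm (r (X m) (Y m) - r (X n) (Y n)) < e"
    if m: "m \<ge> Max {M1,M2,M3,M4}" and n: "n \<ge> Max {M1,M2,M3,M4}" for m n
  proof -
    have "norm (r (X m) (Y m) - r (X n) (Y n))
       \<le> N (X m - X n) * (N (Y m - Y n) + N (Y n)) + N (X n) * N (Y m - Y n)"
      by (rule dominated_diff_bound[OF r])
    also have "\<dots> \<le> N (X m - X n) * (1 + B2) + B1 * N (Y m - Y n)"
      using M4[of m n] B1(2)[of n] B2(2)[of n] m n d B1(1) B2(1) by (intro add_mono mult_mono) auto
    also have "\<dots> < d * (1 + B2) + B1 * d"
      using M3[of m n] M4[of m n] m n B1(1) B2(1) by (intro add_strict_mono mult_strict_right_mono mult_strict_left_mono) auto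
    also have "\<dots> \<le> e" using de by (simp add: algebra_simps)
    finally show ?thesis .
  qed
  then show "\<exists>M. \<forall>m\<ge>M. \<forall>n\<ge>M. norm (r (X m) (Y m) - r (X n) (Y n)) < e" by blast
qed

text \<open>Independence of the chosen representatives: along equivalent sequences the values of r
  differ by a null sequence.\<close>

lemma rH_lim:
  assumes r: "dominated r" and X: "s_cauchy p q X" and Y: "s_cauchy p q Y"
  shows "(\<lambda>n. r (X n) (Y n)) \<longlonglongrightarrow> rH r (hcls p q X) (hcls p q Y)"
proof -
  let ?X = "hrep (hcls p q X)" and ?Y = "hrep (hcls p q Y)"
  note X' = hrep_hcls[OF X] and Y' = hrep_hcls[OF Y]
  have lim: "(\<lambda>n. r (?X n) (?Y n)) \<longlonglongrightarrow> rH r (hcls p q X) (hcls p q Y)"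
    unfolding rH_def using dominated_convergent[OF r X'(1) Y'(1)] by (simp add: convergent_LIMSEQ_iff)
  obtain B1 M1 where B1: "B1 > 0" "\<And>n. n \<ge> M1 \<Longrightarrow> N (?X n) \<le> B1" using s_cauchy_bounded[OF X'(1)] by blast
  obtain B2 M2 where B2: "B2 > 0" "\<And>n. n \<ge> M2 \<Longrightarrow> N (?Y n) \<le> B2" using s_cauchy_bounded[OF Y'(1)] by blast
  have "(\<lambda>n. N (X n - ?X n) * (N (Y n - ?Y n) + B2) + B1 * N (Y n - ?Y n)) \<longlonglongrightarrow> 0 * (0 + B2) + B1 * 0"
    using X'(2)[unfolded s_equiv_iff] Y'(2)[unfolded s_equiv_iff]
    by (intro tendsto_add tendsto_mult tendsto_const)
  then have "(\<lambda>n. N (X n - ?X n) * (N (Y n - ?Y n) + B2) + B1 * N (Y n - ?Y n)) \<longlonglongrightarrow> 0" by simp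
  then have "(\<lambda>n. r (X n) (Y n) - r (?X n) (?Y n)) \<longlonglongrightarrow> 0"
  proof (rule Lim_null_comparison[rotated], intro eventually_sequentiallyI[of "max M1 M2"])
    fix n assume n: "max M1 M2 \<le> n"
    have "norm (r (X n) (Y n) - r (?X n) (?Y n))
       \<le> N (X n - ?X n) * (N (Y n - ?Y n) + N (?Y n)) + N (?X n) * N (Y n - ?Y n)"
      by (rule dominated_diff_bound[OF r])
    also have "\<dots> \<le> N (X n - ?X n) * (N (Y n - ?Y n) + B2) + B1 * N (Y n - ?Y n)"
      using n B1(1) B2(1) B1(2)[of n] B2(2)[of n] by (intro add_mono mult_mono) auto
    finally show "norm (r (X n) (Y n) - r (?X n) (?Y n)) \<le>
      N (X n - ?X n) * (N (Y n - ?Y n) + B2) + B1 * N (Y n - ?Y n)" .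
  qed
  from tendsto_add[OF this lim] show ?thesis by simp
qed

lemma rH_hemb: "dominated r \<Longrightarrow> rH r (hemb p q a) (hemb p q b) = r a b"
  using rH_lim[OF _ s_cauchy_const s_cauchy_const, of r a b]
  by (simp add: hemb_def LIMSEQ_const_iff)

lemma rH_semi_ip:
  assumes r: "dominated r"
  shows "semi_ip (hspace p q) (hplus p q) (hscale sc p q) (rH r)"
proof -
  interpret r: semi_ip UNIV "(+)" sc r using r by (simp add: dominated_def)
  note L = rH_lim[OF r]
  show ?thesis
  proof
    fix h k assume "h \<in> hspace p q" "k \<in> hspace p q"
    then obtain X Y where X: "h = hcls p q X" "s_cauchy p q X" and Y: "k = hcls p q Y" "s_cauchy p q Y"
      by (metis hspace_cases)
    show "hplus p q h k \<in> hspace p q" using X Y by (simp add: hplus_hcls s_cauchy_add)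
    have "(\<lambda>n. r (Y n) (X n)) \<longlonglongrightarrow> cnj (rH r h k)"
      using tendsto_cnj[OF L[OF X(2) Y(2)]] X Y by (simp add: r.ip_cnj[of "X _" "Y _"])
    then show "rH r k h = cnj (rH r h k)" using L[OF Y(2) X(2)] X Y LIMSEQ_unique by blast
  next
    fix h and c :: complex assume "h \<in> hspace p q"
    then obtain X where X: "h = hcls p q X" "s_cauchy p q X" by (metis hspace_cases)
    show "hscale sc p q c h \<in> hspace p q" using X by (simp add: hscale_hcls s_cauchy_sc)
    have "(\<lambda>n. Re (r (X n) (X n))) \<longlonglongrightarrow> Re (rH r h h)"
      using tendsto_Re[OF L[OF X(2) X(2)]] X by simp
    then show "0 \<le> Re (rH r h h)" by (rule LIMSEQ_le_const) (auto intro: r.ip_pos)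
    fix g assume "g \<in> hspace p q"
    then obtain Z where Z: "g = hcls p q Z" "s_cauchy p q Z" by (metis hspace_cases)
    have "(\<lambda>n. r (Z n) (sc c (X n))) \<longlonglongrightarrow> c * rH r g h"
      using tendsto_mult_left[OF L[OF Z(2) X(2)], of c] X Z by simp
    then show "rH r g (hscale sc p q c h) = c * rH r g h"
      using L[OF Z(2) s_cauchy_sc[OF X(2)], of c] X Z LIMSEQ_unique by (auto simp: hscale_hcls)
  next
    fix h k g assume "h \<in> hspace p q" "k \<in> hspace p q" "g \<in> hspace p q"
    then obtain X Y Z where X: "h = hcls p q X" "s_cauchy p q X" and Y: "k = hcls p q Y" "s_cauchy p q Y"
      and Z: "g = hcls p q Z" "s_cauchy p q Z"
      by (metis hspace_cases)
    have "(\<lambda>n. r (Z n) (X n + Y n)) \<longlonglongrightarrow> rH r g h + rH r g k"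
      using tendsto_add[OF L[OF Z(2) X(2)] L[OF Z(2) Y(2)]] X Y Z by simp
    then show "rH r g (hplus p q h k) = rH r g h + rH r g k"
      using L[OF Z(2) s_cauchy_add[OF X(2) Y(2)]] X Y Z LIMSEQ_unique by (auto simp: hplus_hcls)
  qed
qed

section \<open>The completion as a Hilbert space\<close>

lemma hinner_eq: "hinner p q = rH sf"
  by (intro ext) (simp add: hinner_def rH_def)

sublocale h: semi_ip "hspace p q" "hplus p q" "hscale sc p q" "hinner p q"
  unfolding hinner_eq by (rule rH_semi_ip[OF dominated_s])

lemma hnorm_eq: "hnorm p q = h.nrm"
  by (intro ext) (simp add: hnorm_def h.nrm_def)

lemma hminus_eq: "hminus sc p q = h.dif"
  by (intro ext) (simp add: hminus_def h.dif_def)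

lemma h_nrm_lim:
  assumes "s_cauchy p q X"
  shows "(\<lambda>n. N (X n)) \<longlonglongrightarrow> h.nrm (hcls p q X)"
  unfolding N_def h.nrm_def unfolding hinner_eq
  by (intro tendsto_intros rH_lim dominated_s assms)

lemma dif_hcls:
  assumes "s_cauchy p q X" "s_cauchy p q Y"
  shows "h.dif (hcls p q X) (hcls p q Y) = hcls p q (\<lambda>n. X n + sc (-1) (Y n))"
  using assms by (simp add: h.dif_def hscale_hcls hplus_hcls s_cauchy_sc)

lemma h_nrm_dif_lim:
  assumes "s_cauchy p q X" "s_cauchy p q Y"
  shows "(\<lambda>n. N (X n - Y n)) \<longlonglongrightarrow> h.nrm (h.dif (hcls p q X) (hcls p q Y))"
proof -
  have "N (X n - Y n) = N (X n + sc (-1) (Y n))" for n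
    unfolding N_dif by (simp add: N_eq s.dif_def)
  then show ?thesis
    unfolding dif_hcls[OF assms] using h_nrm_lim[OF s_cauchy_add[OF assms(1) s_cauchy_sc[OF assms(2)]]] by simp
qed

text \<open>Density of V, in the form used by the extension arguments below.\<close>

lemma hemb_tends:
  assumes X: "s_cauchy p q X"
  shows "h.tends (\<lambda>k. hemb p q (X k)) (hcls p q X)"
  unfolding h.tends_def
proof (rule LIMSEQ_I)
  fix e :: real assume e: "e > 0"
  then have "e / 2 > 0" by simp
  then obtain M where M: "\<And>m n. m \<ge> M \<Longrightarrow> n \<ge> M \<Longrightarrow> N (X m - X n) < e / 2"
    using X unfolding s_cauchy_iff by blast
  have "h.nrm (h.dif (hemb p q (X k)) (hcls p q X)) < e" if k: "k \<ge> M" for k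
  proof -
    have "(\<lambda>n. N (X k - X n)) \<longlonglongrightarrow> h.nrm (h.dif (hemb p q (X k)) (hcls p q X))"
      unfolding hemb_def by (rule h_nrm_dif_lim[OF s_cauchy_const X])
    then have "h.nrm (h.dif (hemb p q (X k)) (hcls p q X)) \<le> e / 2"
      by (rule LIMSEQ_le_const2) (use M k in \<open>auto intro!: exI[of _ M] less_imp_le\<close>)
    then show ?thesis using e by simp
  qed
  then show "\<exists>M. \<forall>k\<ge>M. norm (h.nrm (h.dif (hemb p q (X k)) (hcls p q X)) - 0) < e"
    using X by auto
qed

lemma nrm_dif_hemb: "h.nrm (h.dif (hemb p q a) (hemb p q b)) = N (a - b)"
  using h_nrm_dif_lim[OF s_cauchy_const s_cauchy_const, of a b] by (simp add: hemb_def LIMSEQ_const_iff)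

text \<open>Each X n is replaced by a vector v n of V at distance below 1 / (n + 1). The sequence v
  is then Cauchy in V, and its class is the limit.\<close>

lemma h_complete:
  assumes X: "\<And>n. X n \<in> hspace p q"
    and C: "\<And>e. e > 0 \<Longrightarrow> \<exists>M. \<forall>m\<ge>M. \<forall>n\<ge>M. h.nrm (h.dif (X m) (X n)) < e"
  shows "\<exists>x\<in>hspace p q. h.tends X x"
proof -
  have "\<exists>v. h.nrm (h.dif (X n) (hemb p q v)) < 1 / Suc n" for n
  proof -
    obtain Y where Y: "X n = hcls p q Y" "s_cauchy p q Y" using X hspace_cases by metis
    have "\<forall>\<^sub>F k in sequentially. h.nrm (h.dif (hemb p q (Y k)) (X n)) < 1 / Suc n"
      using hemb_tends[OF Y(2)] unfolding h.tends_def Y(1) by (rule order_tendstoD) simp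
    then obtain k where "h.nrm (h.dif (hemb p q (Y k)) (X n)) < 1 / Suc n"
      using eventually_happens by fastforce
    then show ?thesis using h.nrm_dif_commute[OF X[of n] hemb_in] by metis
  qed
  then obtain v where v: "\<And>n. h.nrm (h.dif (X n) (hemb p q (v n))) < 1 / Suc n" by metis
  have "s_cauchy p q v" unfolding s_cauchy_iff
  proof (intro allI impI)
    fix e :: real assume e: "e > 0"
    then have e3: "e / 3 > 0" by simp
    obtain M1 where M1: "\<And>m n. m \<ge> M1 \<Longrightarrow> n \<ge> M1 \<Longrightarrow> h.nrm (h.dif (X m) (X n)) < e / 3"
      using C[OF e3] by blast
    obtain M2 where M2: "1 / Suc M2 < e / 3" using nat_approx_posE[OF e3] by blast
    have "N (v m - v n) < e" if mn: "m \<ge> max M1 M2" "n \<ge> max M1 M2" for m n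
    proof -
      have "1 / Suc m \<le> 1 / Suc M2" "1 / Suc n \<le> 1 / Suc M2" using mn by (simp_all add: field_simps)
      then have "h.nrm (h.dif (hemb p q (v m)) (X m)) < e/3" "h.nrm (h.dif (X n) (hemb p q (v n))) < e/3"
        using v[of m] v[of n] M2 h.nrm_dif_commute[OF X[of m] hemb_in[of "v m"]] by linarith+
      moreover have "N (v m - v n) \<le> h.nrm (h.dif (hemb p q (v m)) (X m)) +
         (h.nrm (h.dif (X m) (X n)) + h.nrm (h.dif (X n) (hemb p q (v n))))"
        unfolding nrm_dif_hemb[symmetric]
        using h.nrm_dif_triangle[OF hemb_in[of "v m"] X[of m] hemb_in[of "v n"]]
          h.nrm_dif_triangle[OF X[of m] X[of n] hemb_in[of "v n"]] by linarith
      ultimately show ?thesis using M1[of m n] mn by simp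
    qed
    then show "\<exists>M. \<forall>m\<ge>M. \<forall>n\<ge>M. N (v m - v n) < e" by blast
  qed
  note vc = this
  have lim: "(\<lambda>n. 1 / Suc n + h.nrm (h.dif (hemb p q (v n)) (hcls p q v))) \<longlonglongrightarrow> 0"
    using tendsto_add[OF LIMSEQ_Suc[OF lim_1_over_n] hemb_tends[OF vc, unfolded h.tends_def]] by simp
  have "h.tends X (hcls p q v)" unfolding h.tends_def
  proof (rule Lim_null_comparison[OF _ lim], intro always_eventually allI)
    fix n
    show "norm (h.nrm (h.dif (X n) (hcls p q v))) \<le> 1 / Suc n + h.nrm (h.dif (hemb p q (v n)) (hcls p q v))"
      using h.nrm_dif_triangle[OF X[of n] hemb_in[of "v n"] hcls_in[OF vc]] v[of n] X[of n] vc by simp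
  qed
  then show ?thesis using vc by (intro bexI) auto
qed

lemma hcls_eqI:
  assumes "h \<in> hspace p q" "k \<in> hspace p q" "h.nrm (h.dif h k) = 0"
  shows "h = k"
proof -
  obtain X Y where X: "h = hcls p q X" "s_cauchy p q X" and Y: "k = hcls p q Y" "s_cauchy p q Y"
    using assms by (metis hspace_cases)
  then have "s_equiv p q X Y"
    using h_nrm_dif_lim[OF X(2) Y(2)] assms(3) by (simp add: s_equiv_iff)
  then show ?thesis using X Y hcls_eq_iff by simp
qed

sublocale h: hilb "hspace p q" "hplus p q" "hscale sc p q" "hinner p q" "hzero p q"
proof
  show "hzero p q \<in> hspace p q" by (simp add: hzero_def s_cauchy_const)
  fix x assume "x \<in> hspace p q"
  then obtain X where X: "x = hcls p q X" "s_cauchy p q X" by (metis hspace_cases)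
  have "sf a 0 = 0" for a using form_diff_right[OF s_form, of a "0::'v" 0] by simp
  then show "hinner p q x (hzero p q) = 0"
    using rH_lim[OF dominated_s X(2) s_cauchy_const[of 0]] X(1)
    by (simp add: hinner_eq hzero_def LIMSEQ_const_iff)
next
  fix x y assume xy: "x \<in> hspace p q" "y \<in> hspace p q"
    and eq: "\<And>z. z \<in> hspace p q \<Longrightarrow> hinner p q z x = hinner p q z y"
  have "h.nrm (h.dif x y) = 0" unfolding h.nrm_def using xy eq by simp
  then show "x = y" using xy hcls_eqI by blast
next
  fix X :: "nat \<Rightarrow> (nat \<Rightarrow> 'v) set"
  assume "\<And>n. X n \<in> hspace p q" and "\<And>e. e > 0 \<Longrightarrow> \<exists>M. \<forall>m\<ge>M. \<forall>n\<ge>M. h.nrm (h.dif (X m) (X n)) < e"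
  then show "\<exists>x\<in>hspace p q. h.tends X x" by (intro h_complete)
qed

section \<open>Operators representing dominated forms\<close>

abbreviation "HS \<equiv> hspace p q"

lemma rH_le:
  assumes r: "dominated r" and x: "x \<in> HS"
  shows "Re (rH r x x) \<le> Re (hinner p q x x)"
proof -
  obtain X where X: "x = hcls p q X" "s_cauchy p q X" using x by (metis hspace_cases)
  have "(\<lambda>n. Re (r (X n) (X n))) \<longlonglongrightarrow> Re (rH r x x)" "(\<lambda>n. Re (sf (X n) (X n))) \<longlonglongrightarrow> Re (rH sf x x)"
    unfolding X(1) by (intro tendsto_Re rH_lim r dominated_s X(2))+
  then show ?thesis unfolding hinner_eq
    by (rule LIMSEQ_le) (use r in \<open>auto simp: dominated_def\<close>)
qed

lemma rH_bound:
  assumes r: "dominated r" and "x \<in> HS" "y \<in> HS"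
  shows "cmod (rH r x y) \<le> h.nrm x * h.nrm y"
proof -
  interpret r: semi_ip HS "hplus p q" "hscale sc p q" "rH r" by (rule rH_semi_ip[OF r])
  have "cmod (rH r x y) \<le> r.nrm x * r.nrm y" by (rule r.cauchy_schwarz) (use assms in auto)
  also have "\<dots> \<le> h.nrm x * h.nrm y"
    using rH_le[OF r] assms by (intro mult_mono) (auto simp: r.nrm_def h.nrm_def r.ip_pos h.ip_pos)
  finally show ?thesis .
qed

text \<open>The Riesz operator of the extended form. The value {} outside the completion is the
  normalisation in \<open>is_bop\<close>.\<close>

definition rop :: "('v \<Rightarrow> 'v \<Rightarrow> complex) \<Rightarrow> (nat \<Rightarrow> 'v) set \<Rightarrow> (nat \<Rightarrow> 'v) set" where
  "rop r k = (if k \<in> HS then SOME y. y \<in> HS \<and> (\<forall>x\<in>HS. rH r x k = hinner p q x y) else {})"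

lemma
  assumes r: "dominated r" and k: "k \<in> HS"
  shows rop_closed: "rop r k \<in> HS"
    and ip_rop: "x \<in> HS \<Longrightarrow> hinner p q x (rop r k) = rH r x k"
proof -
  interpret r: semi_ip HS "hplus p q" "hscale sc p q" "rH r" by (rule rH_semi_ip[OF r])
  have "\<exists>y\<in>HS. \<forall>x\<in>HS. rH r x k = hinner p q x y"
  proof (rule h.riesz[where C = "h.nrm k"])
    fix x assume x: "x \<in> HS"
    show "cmod (rH r x k) \<le> h.nrm k * h.nrm x" using rH_bound[OF r x k] by (simp add: mult.commute)
  qed (use k in auto)
  then have "\<exists>y. y \<in> HS \<and> (\<forall>x\<in>HS. rH r x k = hinner p q x y)" by blast
  then have "rop r k \<in> HS \<and> (\<forall>x\<in>HS. rH r x k = hinner p q x (rop r k))"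
    unfolding rop_def if_P[OF k] by (rule someI_ex)
  then show "rop r k \<in> HS" "x \<in> HS \<Longrightarrow> hinner p q x (rop r k) = rH r x k" by auto
qed

lemma hemb_ext:
  assumes "x \<in> HS" "y \<in> HS" "\<And>a. hinner p q (hemb p q a) x = hinner p q (hemb p q a) y"
  shows "x = y"
proof (rule h.ip_ext)
  fix z assume "z \<in> HS"
  then obtain Z where Z: "z = hcls p q Z" "s_cauchy p q Z" by (metis hspace_cases)
  have "(\<lambda>n. hinner p q (hemb p q (Z n)) x) \<longlonglongrightarrow> hinner p q z x" if "x \<in> HS" for x
    unfolding Z(1) using Z that by (intro h.tends_ip hemb_tends h.tends_const) auto
  from this[OF assms(1)] this[OF assms(2)] show "hinner p q z x = hinner p q z y"
    unfolding assms(3) by (rule LIMSEQ_unique)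
qed (use assms in auto)

lemma is_bop_tends:
  assumes T: "is_bop sc p q T" and X: "s_cauchy p q X"
  shows "h.tends (\<lambda>n. T (hemb p q (X n))) (T (hcls p q X))"
proof -
  obtain C where C: "\<And>h. h \<in> HS \<Longrightarrow> h.nrm (T h) \<le> C * h.nrm h"
    using T unfolding is_bop_def hnorm_eq by blast
  have dif: "T (h.dif x y) = h.dif (T x) (T y)" if "x \<in> HS" "y \<in> HS" for x y
    using T that unfolding is_bop_def h.dif_def by simp
  have cl: "T x \<in> HS" if "x \<in> HS" for x using T that unfolding is_bop_def by blast
  have lim: "(\<lambda>n. C * h.nrm (h.dif (hemb p q (X n)) (hcls p q X))) \<longlonglongrightarrow> 0"
    using tendsto_mult_left[OF hemb_tends[OF X, unfolded h.tends_def], of C] by simp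
  show ?thesis unfolding h.tends_def
    by (rule Lim_null_comparison[OF _ lim])
      (use X C cl in \<open>auto intro!: always_eventually simp: dif[symmetric]\<close>)
qed

lemma is_bop_rop:
  assumes r: "dominated r"
  shows "is_bop sc p q (rop r)"
  unfolding is_bop_def hnorm_eq
proof (intro conjI ballI allI impI)
  interpret r: semi_ip HS "hplus p q" "hscale sc p q" "rH r" by (rule rH_semi_ip[OF r])
  note [simp] = rop_closed[OF r] ip_rop[OF r]
  show "rop r h \<in> HS" if "h \<in> HS" for h using that by simp
  show "rop r (hplus p q h k) = hplus p q (rop r h) (rop r k)" if "h \<in> HS" "k \<in> HS" for h k
    using that by (intro h.ip_ext) auto
  show "rop r (hscale sc p q z h) = hscale sc p q z (rop r h)" if "h \<in> HS" for z h
    using that by (intro h.ip_ext) auto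
  show "rop r h = {}" if "h \<notin> HS" for h using that by (simp add: rop_def)
  have "h.nrm (rop r h) \<le> 1 * h.nrm h" if h: "h \<in> HS" for h
  proof -
    have "(h.nrm (rop r h))\<^sup>2 = Re (rH r (rop r h) h)" using h by (simp add: h.nrm_sq)
    also have "\<dots> \<le> h.nrm (rop r h) * h.nrm h"
      using rH_bound[OF r _ h, of "rop r h"] complex_Re_le_cmod[of "rH r (rop r h) h"] h by simp
    finally have "h.nrm (rop r h) * h.nrm (rop r h) \<le> h.nrm (rop r h) * h.nrm h"
      by (simp add: power2_eq_square)
    moreover have "0 \<le> h.nrm (rop r h)" "0 \<le> h.nrm h" using h by simp_all
    ultimately show ?thesis by (metis mult_1 mult_left_le_imp_le order_le_less)
  qed
  then show "\<exists>C. \<forall>h\<in>HS. h.nrm (rop r h) \<le> C * h.nrm h" by blast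
qed

text \<open>The definite description needs uniqueness: two representing operators agree on V by
  \<open>hemb_ext\<close>, on the completion by boundedness and density, and outside it by
  normalisation.\<close>

lemma bop_of_eq:
  assumes r: "dominated r"
  shows "bop_of sc p q r = rop r"
  unfolding bop_of_def
proof (rule the_equality)
  note [simp] = rop_closed[OF r] ip_rop[OF r]
  show "is_bop sc p q (rop r) \<and> (\<forall>a b. r a b = hinner p q (hemb p q a) (rop r (hemb p q b)))"
    using is_bop_rop[OF r] by (simp add: rH_hemb[OF r])
  fix T assume T: "is_bop sc p q T \<and> (\<forall>a b. r a b = hinner p q (hemb p q a) (T (hemb p q b)))"
  have cl: "T x \<in> HS" if "x \<in> HS" for x using T that unfolding is_bop_def by blast
  have emb: "T (hemb p q b) = rop r (hemb p q b)" for b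
    using T by (intro hemb_ext) (auto simp: cl rH_hemb[OF r])
  show "T = rop r"
  proof
    fix h
    show "T h = rop r h"
    proof (cases "h \<in> HS")
      case True
      then obtain X where X: "h = hcls p q X" "s_cauchy p q X" by (metis hspace_cases)
      have "h.tends (\<lambda>n. rop r (hemb p q (X n))) (T h)"
        using is_bop_tends[of T, OF _ X(2)] T X(1) by (simp add: emb)
      moreover have "h.tends (\<lambda>n. rop r (hemb p q (X n))) (rop r h)"
        using is_bop_tends[OF is_bop_rop[OF r] X(2)] X(1) by simp
      ultimately show ?thesis by (rule h.tends_unique) (use True cl in auto)
    next
      case False
      then show ?thesis using T by (simp add: rop_def is_bop_def)
    qed
  qed
qed

lemma hilb_op_bop_of:
  assumes r: "dominated r"
  shows "hilb_op HS (hplus p q) (hscale sc p q) (hinner p q) (hzero p q) (bop_of sc p q r)"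
  unfolding bop_of_eq[OF r]
proof unfold_locales
  interpret r: semi_ip HS "hplus p q" "hscale sc p q" "rH r" by (rule rH_semi_ip[OF r])
  note [simp] = rop_closed[OF r] ip_rop[OF r]
  fix x assume x: "x \<in> HS"
  then show "rop r x \<in> HS" "0 \<le> Re (hinner p q x (rop r x))"
    "Re (hinner p q x (rop r x)) \<le> Re (hinner p q x x)"
    by (simp_all add: r.ip_pos rH_le[OF r])
  fix y assume y: "y \<in> HS"
  have "hinner p q (rop r x) y = cnj (hinner p q y (rop r x))" using x y by (intro h.ip_cnj) auto
  also have "\<dots> = cnj (rH r y x)" using x y by simp
  also have "\<dots> = rH r x y" using x y r.ip_cnj[of y x] by simp
  also have "\<dots> = hinner p q x (rop r y)" using x y by simp
  finally show "hinner p q (rop r x) y = hinner p q x (rop r y)" .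
qed

section \<open>P, Q = 1 - P and the interpolated form\<close>

sublocale P: hilb_op HS "hplus p q" "hscale sc p q" "hinner p q" "hzero p q" "bop_of sc p q p"
  by (rule hilb_op_bop_of[OF dominated_p])

lemma ip_bop_of:
  "dominated r \<Longrightarrow> x \<in> HS \<Longrightarrow> y \<in> HS \<Longrightarrow> hinner p q x (bop_of sc p q r y) = rH r x y"
  by (simp add: bop_of_eq ip_rop)

lemma rH_p_plus_q: "x \<in> HS \<Longrightarrow> y \<in> HS \<Longrightarrow> rH p x y + rH q x y = hinner p q x y"
proof -
  assume "x \<in> HS" "y \<in> HS"
  then obtain X Y where X: "x = hcls p q X" "s_cauchy p q X" and Y: "y = hcls p q Y" "s_cauchy p q Y"
    by (metis hspace_cases)
  have "(\<lambda>n. p (X n) (Y n) + q (X n) (Y n)) \<longlonglongrightarrow> rH p x y + rH q x y"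
    unfolding X(1) Y(1) by (intro tendsto_add rH_lim dominated_p dominated_q X Y)
  then have "(\<lambda>n. sf (X n) (Y n)) \<longlonglongrightarrow> rH p x y + rH q x y" by (simp add: sform_def)
  then show ?thesis using rH_lim[OF dominated_s X(2) Y(2)] X(1) Y(1) LIMSEQ_unique
    unfolding hinner_eq by blast
qed

text \<open>The relation P + Q = 1, which places Q in the calculus of P.\<close>

lemma bop_of_q: "y \<in> HS \<Longrightarrow> bop_of sc p q q y = h.dif y (bop_of sc p q p y)"
proof (rule h.ip_ext)
  interpret Q: hilb_op HS "hplus p q" "hscale sc p q" "hinner p q" "hzero p q" "bop_of sc p q q"
    by (rule hilb_op_bop_of[OF dominated_q])
  assume y: "y \<in> HS"
  then show "bop_of sc p q q y \<in> HS" "h.dif y (bop_of sc p q p y) \<in> HS" by simp_all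
  fix z assume "z \<in> HS"
  then show "hinner p q z (bop_of sc p q q y) = hinner p q z (h.dif y (bop_of sc p q p y))"
    using y rH_p_plus_q[of z y] by (simp add: ip_bop_of dominated_p dominated_q eq_diff_eq add.commute)
qed

lemma opfun_eq:
  assumes T: "hilb_op HS (hplus p q) (hscale sc p q) (hinner p q) (hzero p q) T"
    and f: "continuous_on {0..1} f" and h: "h \<in> HS"
  shows "opfun sc p q f T h = hilb_op.fc HS (hplus p q) (hscale sc p q) (hinner p q) (hzero p q) T f h"
proof -
  interpret T: hilb_op HS "hplus p q" "hscale sc p q" "hinner p q" "hzero p q" T by (rule T)
  have pop: "polyop sc p q T g k = T.pop g k" for g k by (simp add: polyop_def T.pop_def)
  have unif: "(\<forall>\<epsilon>>0. \<exists>M. \<forall>n\<ge>M. \<forall>x\<in>{0..1}. \<bar>poly (g n) x - f x\<bar> < \<epsilon>) \<longleftrightarrow>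
      uniform_limit {0..1} (\<lambda>n. poly (g n)) f sequentially" for g
    by (simp add: uniform_limit_iff eventually_sequentially dist_real_def)
  have "opfun sc p q f T = (\<lambda>h. if h \<in> HS then T.fc f h else {})"
    unfolding opfun_def pop unif hnorm_eq hminus_eq h.tends_def[symmetric]
  proof (rule the_equality)
    show "(\<forall>h. h \<notin> HS \<longrightarrow> (if h \<in> HS then T.fc f h else {}) = {}) \<and>
      (\<forall>h\<in>HS. (if h \<in> HS then T.fc f h else {}) \<in> HS) \<and>
      (\<forall>h\<in>HS. \<forall>g. uniform_limit {0..1} (\<lambda>n. poly (g n)) f sequentially \<longrightarrow>
        h.tends (\<lambda>n. T.pop (g n) h) (if h \<in> HS then T.fc f h else {}))"
      using f T.fc_tends by auto
    fix F assume F: "(\<forall>h. h \<notin> HS \<longrightarrow> F h = {}) \<and> (\<forall>h\<in>HS. F h \<in> HS) \<and>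
      (\<forall>h\<in>HS. \<forall>g. uniform_limit {0..1} (\<lambda>n. poly (g n)) f sequentially \<longrightarrow>
        h.tends (\<lambda>n. T.pop (g n) h) (F h))"
    \<comment> \<open>Uniqueness needs at least one approximating sequence; without one the
      condition on F would be vacuous.\<close>
    obtain g where g: "uniform_limit {0..1} (\<lambda>n. poly (g n)) f sequentially"
      using uniform_poly_approx[OF f] by blast
    have "F h = T.fc f h" if "h \<in> HS" for h
      by (rule T.fc_unique[OF g f that]) (use F g that in auto)
    then show "F = (\<lambda>h. if h \<in> HS then T.fc f h else {})" using F by (auto simp: fun_eq_iff)
  qed
  then show ?thesis using h by simp
qed

text \<open>For 0 < t < 1 both exponents are positive, so \<open>pw\<close> is the ordinary power
  and continuous at 0. After Q is rewritten as 1 - P the two powers multiply to a single function of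
  P.\<close>

lemma gamma_interp_eq:
  assumes t: "0 < t" "t < 1"
  shows "gamma_interp sc p q t a b = hinner p q (hemb p q a) (P.fc (geo t) (hemb p q b))"
proof -
  note Q = hilb_op_bop_of[OF dominated_q]
  have pw: "pw s = (\<lambda>x. x powr s)" if "s > 0" for s using that by (auto simp: pw_def)
  have c: "continuous_on {0..1::real} (\<lambda>x. x powr s)" if "s > 0" for s
    using that by (intro continuous_on_powr' continuous_intros) auto
  have c1: "continuous_on {0..1::real} (\<lambda>x. (1 - x) powr t)"
    using t by (intro continuous_on_powr' continuous_intros) auto
  have "opfun sc p q (pw t) (bop_of sc p q q) (hemb p q b) = P.fc (\<lambda>x. (1 - x) powr t) (hemb p q b)"
    unfolding pw[OF t(1)] opfun_eq[OF Q c[OF t(1)] hemb_in]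
    by (rule P.fc_one_minus[OF c[OF t(1)] hemb_in Q bop_of_q])
  moreover have "opfun sc p q (pw (1 - t)) (bop_of sc p q p) (P.fc (\<lambda>x. (1 - x) powr t) (hemb p q b))
      = P.fc (\<lambda>x. x powr (1 - t)) (P.fc (\<lambda>x. (1 - x) powr t) (hemb p q b))"
    using t c1 unfolding pw[of "1 - t", OF diff_gt_0_iff_gt[THEN iffD2, OF t(2)]]
    by (intro opfun_eq hilb_op_bop_of[OF dominated_p] c) auto
  moreover have "P.fc (\<lambda>x. x powr (1 - t)) (P.fc (\<lambda>x. (1 - x) powr t) (hemb p q b)) = P.fc (geo t) (hemb p q b)"
    unfolding geo_def[abs_def] using t c1 by (intro P.fc_mult c) auto
  ultimately show ?thesis unfolding gamma_interp_def by simp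
qed

text \<open>The splitting cost with both parts in V, where Phi can be applied directly.\<close>

definition split_form :: "real \<Rightarrow> 'v \<Rightarrow> 'v \<Rightarrow> real" where
  "split_form l a b = Re (p b b) + l * Re (q (a - b) (a - b))"

lemma split_val_eq:
  assumes "x \<in> HS" "y \<in> HS"
  shows "P.split_val l x y = Re (rH p y y) + l * Re (rH q (h.dif x y) (h.dif x y))"
proof -
  have "Re (rH q z z) = Re (hinner p q z z) - Re (rH p z z)" if "z \<in> HS" for z
    using arg_cong[OF rH_p_plus_q[OF that that], of Re] by simp
  then show ?thesis
    unfolding P.split_val_def using assms by (simp add: ip_bop_of[OF dominated_p] del: h.ip_dif h.ip_dif_left)
qed

lemma split_val_lim:
  assumes X: "s_cauchy p q X"
  shows "(\<lambda>n. split_form l a (X n)) \<longlonglongrightarrow> P.split_val l (hemb p q a) (hcls p q X)"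
proof -
  \<comment> \<open>Passes from the group subtraction to the one used in the completion.\<close>
  have q: "q (a - b) (a - b) = q (a + sc (-1) b) (a + sc (-1) b)" for b
    using semi_ip.ip_pl[OF q_form] semi_ip.ip_pl_left[OF q_form] semi_ip.ip_sc[OF q_form] semi_ip.ip_sc_left[OF q_form]
    by (simp add: form_diff_left[OF q_form] form_diff_right[OF q_form])
  have c: "s_cauchy p q (\<lambda>n. a + sc (-1) (X n))"
    by (intro s_cauchy_add s_cauchy_const s_cauchy_sc X)
  show ?thesis
    unfolding split_val_eq[OF hemb_in hcls_in[OF X]]
    unfolding split_form_def q hemb_def dif_hcls[OF s_cauchy_const X]
    by (intro tendsto_add tendsto_mult tendsto_const tendsto_Re rH_lim dominated_p dominated_q X c)
qed

lemma psum_le_split_form: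
  assumes "0 < l"
  shows "Re (hinner p q (hemb p q a) (P.fc (psum l) (hemb p q a))) \<le> split_form l a b"
proof -
  have "P.split_val l (hemb p q a) (hemb p q b) = split_form l a b"
    using split_val_lim[OF s_cauchy_const, of l a b] by (simp add: hemb_def LIMSEQ_const_iff)
  then show ?thesis using P.split_val_minimum[OF assms hemb_in[of a]] hemb_in[of b] by metis
qed

text \<open>The minimiser may lie outside V, so within V the minimum is only approached, along a
  Cauchy sequence representing the minimiser.\<close>

lemma split_form_approx:
  assumes "0 < l" "0 < e"
  shows "\<exists>b. split_form l a b < Re (hinner p q (hemb p q a) (P.fc (psum l) (hemb p q a))) + e"
proof -
  obtain y where y: "y \<in> HS"
    "P.split_val l (hemb p q a) y = Re (hinner p q (hemb p q a) (P.fc (psum l) (hemb p q a)))"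
    using P.split_val_minimum[OF assms(1) hemb_in[of a]] by blast
  obtain X where X: "y = hcls p q X" "s_cauchy p q X" using y(1) by (metis hspace_cases)
  have "\<forall>\<^sub>F n in sequentially. split_form l a (X n) < P.split_val l (hemb p q a) y + e"
    using split_val_lim[OF X(2), of l a] unfolding X(1) by (rule order_tendstoD) (use assms in simp)
  then obtain n where "split_form l a (X n) < P.split_val l (hemb p q a) y + e"
    using eventually_happens by fastforce
  then show ?thesis using y(2) by auto
qed

end

text \<open>If b almost minimises the splitting of a in the source, then Phi b is a competitor for
  Phi a in the target, and its cost is no larger. This gives the inequality for each
  \<open>psum\<close>; nonnegative weights carry it to \<open>geo\<close>.\<close>

theorem gamma_interp_mono:
  fixes \<Phi> :: "'v::ab_group_add \<Rightarrow> 'w::ab_group_add"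
  assumes "form_pair sc1 p1 q1" "form_pair sc2 p2 q2"
    and diff: "\<And>a b. \<Phi> (a - b) = \<Phi> a - \<Phi> b"
    and p: "\<And>a. Re (p2 (\<Phi> a) (\<Phi> a)) \<le> Re (p1 a a)"
    and q: "\<And>a. Re (q2 (\<Phi> a) (\<Phi> a)) \<le> Re (q1 a a)"
    and t: "0 < t" "t < 1"
  shows "Re (gamma_interp sc2 p2 q2 t (\<Phi> a) (\<Phi> a)) \<le> Re (gamma_interp sc1 p1 q1 t a a)"
proof -
  interpret V: form_pair sc1 p1 q1 by (rule assms)
  interpret W: form_pair sc2 p2 q2 by (rule assms)
  define x where "x = hemb p1 q1 a"
  define y where "y = hemb p2 q2 (\<Phi> a)"
  define \<Lambda> where "\<Lambda> f = Re (hinner p1 q1 x (V.P.fc f x))" for f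
  define M where "M f = Re (hinner p2 q2 y (W.P.fc f y))" for f
  have [simp]: "x \<in> hspace p1 q1" "y \<in> hspace p2 q2" by (simp_all add: x_def y_def)
  have psum_le: "M (psum l) \<le> \<Lambda> (psum l)" if l: "0 < l" for l
  proof (rule field_le_epsilon)
    fix e :: real assume "e > 0"
    then obtain b where b: "V.split_form l a b < \<Lambda> (psum l) + e"
      using V.split_form_approx[OF l, of e a] by (auto simp: \<Lambda>_def x_def)
    have "M (psum l) \<le> W.split_form l (\<Phi> a) (\<Phi> b)"
      using W.psum_le_split_form[OF l] by (simp add: M_def y_def)
    also have "\<dots> \<le> V.split_form l a b"
      using p[of b] q[of "a - b"] l by (simp add: V.split_form_def W.split_form_def diff add_mono)
    finally show "M (psum l) \<le> \<Lambda> (psum l) + e" using b by simp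
  qed
  note cg = continuous_on_geo[OF t]
  \<comment> \<open>A constant error e in the scalar inequality becomes e K after pairing with
    y.\<close>
  define K where "K = Re (hinner p2 q2 y y)"
  have K: "K \<ge> 0" by (simp add: K_def W.h.ip_pos)
  have le: "M (geo t) \<le> c\<^sup>2 * \<Lambda> (geo t) + e * K" if c: "1 < c" and e: "0 < e" for c e
  proof -
    obtain J :: "int set" and w l where J: "finite J" and wl: "\<forall>j. 0 \<le> w j \<and> 0 < l j"
      and bd: "\<forall>u\<in>{0..1}. geo t u \<le> (\<Sum>j\<in>J. w j * psum (l j) u) + e \<and>
        (\<Sum>j\<in>J. w j * psum (l j) u) \<le> c\<^sup>2 * geo t u"
      using geo_psum_approx[OF t c e] by blast
    have w: "0 \<le> w j" and l: "0 < l j" for j using wl by auto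
    define S where "S u = (\<Sum>j\<in>J. w j * psum (l j) u)" for u
    have cS: "continuous_on {0..1} S"
      unfolding S_def by (intro continuous_intros continuous_on_psum l)
    have MS: "M S = (\<Sum>j\<in>J. w j * M (psum (l j)))"
      unfolding M_def S_def using J by (subst W.P.ip_fc_sum) (auto intro!: continuous_on_psum l)
    have LS: "\<Lambda> S = (\<Sum>j\<in>J. w j * \<Lambda> (psum (l j)))"
      unfolding \<Lambda>_def S_def using J by (subst V.P.ip_fc_sum) (auto intro!: continuous_on_psum l)
    have "M (geo t) \<le> M (\<lambda>u. S u + e)"
      unfolding M_def using bd by (intro W.P.fc_mono cg continuous_intros cS) (auto simp: S_def)
    also have "\<dots> = M S + e * K"
    proof -
      have const: "W.P.fc (\<lambda>u. e) y = W.P.pop [:e:] y"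
      proof -
        have "poly [:e:] = (\<lambda>u. e)" by auto
        then show ?thesis using W.P.fc_poly[of y "[:e:]"] by simp
      qed
      have "hinner p2 q2 y (W.P.fc (\<lambda>u. S u + e) y) =
          hinner p2 q2 y (W.P.fc S y) + hinner p2 q2 y (W.P.fc (\<lambda>u. e) y)"
        by (rule W.P.ip_fc_add) (auto intro!: cS continuous_intros)
      then show ?thesis unfolding const by (simp add: M_def K_def W.P.ip_pop_const)
    qed
    also have "M S \<le> \<Lambda> S"
      unfolding MS LS by (intro sum_mono mult_left_mono psum_le w l)
    also have "\<Lambda> S \<le> \<Lambda> (\<lambda>u. c\<^sup>2 * geo t u)"
      unfolding \<Lambda>_def using bd by (intro V.P.fc_mono cg continuous_intros cS) (auto simp: S_def)
    also have "\<Lambda> (\<lambda>u. c\<^sup>2 * geo t u) = c\<^sup>2 * \<Lambda> (geo t)"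
      unfolding \<Lambda>_def by (subst V.P.fc_scale[OF cg]) (auto simp: cg simp del: of_real_power)
    finally show ?thesis by simp
  qed
  \<comment> \<open>Both errors vanish together, with c = 1 + d and e = d.\<close>
  have "((\<lambda>d::real. (1 + d)\<^sup>2 * \<Lambda> (geo t) + d * K) \<longlongrightarrow> (1 + 0)\<^sup>2 * \<Lambda> (geo t) + 0 * K) (at_right 0)"
    by (intro tendsto_intros)
  moreover have "\<forall>\<^sub>F d::real in at_right 0. M (geo t) \<le> (1 + d)\<^sup>2 * \<Lambda> (geo t) + d * K"
    using eventually_at_right_less[of "0::real"] by eventually_elim (auto intro!: le)
  ultimately have "M (geo t) \<le> (1 + 0)\<^sup>2 * \<Lambda> (geo t) + 0 * K"
    by (intro tendsto_lowerbound) auto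
  then show ?thesis
    by (simp add: M_def \<Lambda>_def x_def y_def V.gamma_interp_eq[OF t] W.gamma_interp_eq[OF t])
qed

subsection \<open>Schwarz maps and relative entropy\<close>

lemma cscale_mult_left: "cscale ii z a * b = cscale ii z (a * b)"
  by (simp add: cscale_def algebra_simps)

lemma cscale_mult_right: "(\<And>a. ii * a = a * ii) \<Longrightarrow> a * cscale ii z b = cscale ii z (a * b)"
  by (simp add: cscale_def algebra_simps)

text \<open>Polarisation: the value at the square of a + z b is real for every z, and z = 1 and z =
  i determine imaginary and real parts.\<close>

lemma pos_functional_hermitian:
  assumes A: "unital_cstar_algebra ii st" and w: "pos_functional ii st \<omega>"
  shows "\<omega> (st b * a) = cnj (\<omega> (st a * b))"
proof -
  have add: "\<And>a b. \<omega> (a + b) = \<omega> a + \<omega> b" and scl: "\<And>z a. \<omega> (cscale ii z a) = z * \<omega> a"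
    and im: "\<And>a. Im (\<omega> (st a * a)) = 0"
    using w by (auto simp: pos_functional_def)
  have cen: "\<And>a. ii * a = a * ii" and st_add: "\<And>a b. st (a + b) = st a + st b"
    and st_scl: "\<And>z a. st (cscale ii z a) = cscale ii (cnj z) (st a)"
    using A by (auto simp: unital_cstar_algebra_def)
  have "\<omega> (st (a + cscale ii z b) * (a + cscale ii z b)) =
      \<omega> (st a * a) + z * \<omega> (st a * b) + cnj z * \<omega> (st b * a) + cnj z * z * \<omega> (st b * b)" for z
    by (simp add: st_add st_scl distrib_left distrib_right add scl cscale_mult_left cscale_mult_right[OF cen])
  then have "Im (z * \<omega> (st a * b) + cnj z * \<omega> (st b * a)) = 0" for z
    using im[of "a + cscale ii z b"] im[of a] im[of b] by (simp add: algebra_simps)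
  from this[of 1] this[of \<i>] show ?thesis by (simp add: complex_eq_iff)
qed

lemma
  assumes A: "unital_cstar_algebra ii st" and w: "pos_functional ii st \<omega>"
  shows semi_ip_omegaL: "semi_ip UNIV (+) (cscale ii) (omegaL st \<omega>)"
    and semi_ip_omegaR: "semi_ip UNIV (+) (cscale ii) (omegaR st \<omega>)"
proof -
  have add: "\<And>a b. \<omega> (a + b) = \<omega> a + \<omega> b" and scl: "\<And>z a. \<omega> (cscale ii z a) = z * \<omega> a"
    and pos: "\<And>a. 0 \<le> Re (\<omega> (st a * a))"
    using w by (auto simp: pos_functional_def)
  have cen: "\<And>a. ii * a = a * ii" and st_st: "\<And>a. st (st a) = a"
    using A by (auto simp: unital_cstar_algebra_def)
  note herm = pos_functional_hermitian[OF A w]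
  show "semi_ip UNIV (+) (cscale ii) (omegaL st \<omega>)"
    by unfold_locales
      (auto simp: omegaL_def distrib_left add scl pos cscale_mult_right[OF cen] intro: herm)
  show "semi_ip UNIV (+) (cscale ii) (omegaR st \<omega>)"
  proof unfold_locales
    fix x y
    show "omegaR st \<omega> y x = cnj (omegaR st \<omega> x y)"
      using herm[of "st x" "st y"] by (simp add: omegaR_def st_st)
    show "0 \<le> Re (omegaR st \<omega> x x)" using pos[of "st x"] by (simp add: omegaR_def st_st)
  qed (auto simp: omegaR_def distrib_right add scl cscale_mult_left)
qed

text \<open>The Schwarz defect has the form of an adjoint times its element, so omega is real and
  nonnegative on it. The second claim supplies the reality that \<open>pos_functional\<close>
  demands of omega o Phi.\<close>

lemma pos_functional_schwarz:
  assumes S: "unital_schwarz_map ii1 st1 ii2 st2 \<Phi>" and w: "pos_functional ii2 st2 \<omega>"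
  shows "Re (\<omega> (st2 (\<Phi> a) * \<Phi> a)) \<le> Re (\<omega> (\<Phi> (st1 a * a)))"
    and "Im (\<omega> (\<Phi> (st1 a * a))) = 0"
proof -
  obtain x where "\<Phi> (st1 a * a) - \<Phi> (st1 a) * \<Phi> a = st2 x * x"
    using S unfolding unital_schwarz_map_def cstar_le_def cstar_pos_def by blast
  then have "\<Phi> (st1 a * a) = st2 (\<Phi> a) * \<Phi> a + st2 x * x"
    using S by (simp add: unital_schwarz_map_def algebra_simps)
  then show "Re (\<omega> (st2 (\<Phi> a) * \<Phi> a)) \<le> Re (\<omega> (\<Phi> (st1 a * a)))" "Im (\<omega> (\<Phi> (st1 a * a))) = 0"
    using w by (auto simp: pos_functional_def)
qed

lemma pos_functional_comp:
  assumes S: "unital_schwarz_map ii1 st1 ii2 st2 \<Phi>" and w: "pos_functional ii2 st2 \<omega>"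
  shows "pos_functional ii1 st1 (\<omega> \<circ> \<Phi>)"
proof -
  have "0 \<le> Re (\<omega> (\<Phi> (st1 a * a)))" for a
    using pos_functional_schwarz(1)[OF S w, of a] w unfolding pos_functional_def by (meson order_trans)
  then show ?thesis
    using S w pos_functional_schwarz(2)[OF S w]
    by (auto simp: pos_functional_def unital_schwarz_map_def clinear_map_def)
qed

theorem mainTheorem4:
  fixes ii1 :: "'a::{real_normed_algebra_1,banach}" and st1 :: "'a \<Rightarrow> 'a"
    and ii2 :: "'b::{real_normed_algebra_1,banach}" and st2 :: "'b \<Rightarrow> 'b"
    and \<Phi> :: "'a \<Rightarrow> 'b" and \<omega> \<nu> :: "'b \<Rightarrow> complex"
  assumes "unital_cstar_algebra ii1 st1"
    and "unital_cstar_algebra ii2 st2"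
    and "unital_schwarz_map ii1 st1 ii2 st2 \<Phi>"
    and "pos_functional ii2 st2 \<omega>"
    and "pos_functional ii2 st2 \<nu>"
  shows "rel_entropy ii2 st2 \<omega> \<nu> \<ge> rel_entropy ii1 st1 (\<omega> \<circ> \<Phi>) (\<nu> \<circ> \<Phi>)"
proof -
  note A1 = assms(1) and A2 = assms(2) and S = assms(3) and w = assms(4) and v = assms(5)
  have st_1: "st 1 = 1" if "unital_cstar_algebra ii st" for ii :: "'c::{real_normed_algebra_1,banach}" and st
  proof -
    have "st (st 1 * 1) = st 1 * st (st 1)" "st (st 1) = 1" using that unfolding unital_cstar_algebra_def by blast+
    then show ?thesis by simp
  qed
  have st_st: "st1 (st1 a) = a" for a using A1 by (simp add: unital_cstar_algebra_def)
  have \<Phi>1: "\<Phi> 1 = 1" and \<Phi>st: "\<Phi> (st1 a) = st2 (\<Phi> a)" and \<Phi>add: "\<Phi> (a + b) = \<Phi> a + \<Phi> b" for a b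
    using S by (auto simp: unital_schwarz_map_def clinear_map_def)
  have st2_st2: "st2 (st2 a) = a" for a using A2 by (simp add: unital_cstar_algebra_def)
  let ?p1 = "omegaR st1 (\<omega> \<circ> \<Phi>)" and ?q1 = "omegaL st1 (\<nu> \<circ> \<Phi>)"
  let ?p2 = "omegaR st2 \<omega>" and ?q2 = "omegaL st2 \<nu>"
  have le: "Re (gamma_interp (cscale ii2) ?p2 ?q2 t (\<Phi> 1) (\<Phi> 1)) \<le> Re (gamma_interp (cscale ii1) ?p1 ?q1 t 1 1)"
    if "0 < t" "t < 1" for t
  proof (rule gamma_interp_mono)
    show "form_pair (cscale ii1) ?p1 ?q1"
      by (intro form_pair.intro semi_ip_omegaR semi_ip_omegaL A1 pos_functional_comp[OF S] w v)
    show "form_pair (cscale ii2) ?p2 ?q2"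
      by (intro form_pair.intro semi_ip_omegaR semi_ip_omegaL A2 w v)
    show "\<Phi> (a - b) = \<Phi> a - \<Phi> b" for a b using \<Phi>add[of "a - b" b] by simp
    \<comment> \<open>omega^R evaluates a times its adjoint, so the Schwarz inequality is applied to
      the adjoint of a.\<close>
    show "Re (?p2 (\<Phi> a) (\<Phi> a)) \<le> Re (?p1 a a)" for a
      using pos_functional_schwarz(1)[OF S w, of "st1 a"] by (simp add: omegaR_def st_st \<Phi>st st2_st2)
    show "Re (?q2 (\<Phi> a) (\<Phi> a)) \<le> Re (?q1 a a)" for a
      using pos_functional_schwarz(1)[OF S v, of a] by (simp add: omegaL_def)
  qed (use that in auto)
  have "Liminf (at_right 0) (\<lambda>t. ereal ((Re (gamma_interp (cscale ii2) ?p2 ?q2 t 1 1) - Re (?p2 1 1)) / t))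
     \<le> Liminf (at_right 0) (\<lambda>t. ereal ((Re (gamma_interp (cscale ii1) ?p1 ?q1 t 1 1) - Re (?p1 1 1)) / t))"
  proof (rule Liminf_mono)
    have "\<forall>\<^sub>F t::real in at_right 0. 0 < t \<and> t < 1"
      using eventually_at_right_real[of 0 1] by simp
    then show "\<forall>\<^sub>F t in at_right 0.
        ereal ((Re (gamma_interp (cscale ii2) ?p2 ?q2 t 1 1) - Re (?p2 1 1)) / t) \<le>
        ereal ((Re (gamma_interp (cscale ii1) ?p1 ?q1 t 1 1) - Re (?p1 1 1)) / t)"
    proof eventually_elim
      case (elim t)
      \<comment> \<open>Unitality makes the subtracted terms equal, so the difference quotients
        compare like the interpolated forms; the minus sign in the entropy then reverses the
        inequality.\<close>
      have "?p2 1 1 = ?p1 1 1" by (simp add: omegaR_def st_1[OF A1] st_1[OF A2] \<Phi>1)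
      then show ?case using le[of t] elim by (simp add: \<Phi>1 divide_right_mono)
    qed
  qed
  then show ?thesis unfolding rel_entropy_def by (simp add: ereal_minus_le_minus)
qed

end
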